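(* Let $\rho>0$ and let $T=(T_1,\ldots,T_n)\in B(\mathcal H)^n$ be of class $\mathcal C_\rho$. Let $u\in \mathrm{Har}^c_{\mathbf{ball}}(B(\mathcal E))$ have the standard representation $$u(X_1,\ldots,X_n)=\sum_{k=1}^\infty\sum_{|\alpha|=k}X_\alpha^*\otimes B_{(\alpha)}+I\otimes A_{(0)}+\sum_{k=1}^\infty\sum_{|\alpha|=k}X_\alpha\otimes A_{(\alpha)},\qquad X\in[B(\mathcal K)^n]_1,$$ for some $A_{(\alpha)},B_{(\alpha)}\in B(\mathcal E)$, where the series converge in the operator norm topology. Then $$u(T_1,\ldots,T_n):=\lim_{r\to1}u(rT_1,\ldots,rT_n)$$ exists in the operator norm, and $$\|u(T_1,\ldots,T_n)\|\le\|\rho u+(1-\rho)u(0)\|_\infty .$$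
   Context: Let $n\ge1$, let $\mathcal H$ be a complex Hilbert space, $\mathcal K$ a separable infinite-dimensional Hilbert space and $\mathcal E$ a separable Hilbert space. $\mathbb F_n^+$ is the unital free semigroup on generators $g_1,\ldots,g_n$ with identity $g_0$; $|\alpha|$ is the length of $\alpha$. For $T=(T_1,\ldots,T_n)\in B(\mathcal H)^n$, $T_\alpha:=T_{i_1}\cdots T_{i_k}$ if $\alpha=g_{i_1}\cdots g_{i_k}$, and $T_{g_0}:=I$. For $\rho\in(0,\infty)$, $T\in B(\mathcal H)^n$ is of class $\mathcal C_\rho$ if there exist a Hilbert space $\mathcal G\supseteq\mathcal H$ and isometries $V_1,\ldots,V_n\in B(\mathcal G)$ with mutually orthogonal ranges such that $T_\alpha=\rho P_{\mathcal H}V_\alpha|_{\mathcal H}$ for all $\alpha\in\mathbb F_n^+\setminus\{g_0\}$. $[B(\mathcal K)^n]_1:=\{X\in B(\mathcal K)^n:\ \|X_1X_1^*+\cdots+X_nX_n^*\|<1\}$, and $[B(\mathcal K)^n]_1^-$ is the corresponding closed ball. A free holomorphic function on $[B(\mathcal K)^n]_1$ with coefficients in $B(\mathcal E)$ is a map $F(X)=\sum_{k=0}^\infty\sum_{|\alpha|=k}X_\alpha\otimes A_{(\alpha)}$, with $A_{(\alpha)}\in B(\mathcal E)$ and $\limsup_{k\to\infty}\|\sum_{|\alpha|=k}A_{(\alpha)}^*A_{(\alpha)}\|^{1/2k}\le1$ (the series in $k$ then converges in norm). A self-adjoint free pluriharmonic function is $\Re F:=\frac12(F^*+F)$ for a free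 holomorphic $F$; a free pluriharmonic function is $H_1+iH_2$ with $H_1,H_2$ self-adjoint free pluriharmonic. $\mathrm{Har}^c_{\mathbf{ball}}(B(\mathcal E))$ is the set of free pluriharmonic functions on $[B(\mathcal K)^n]_1$ with coefficients in $B(\mathcal E)$ that have a continuous extension (in operator norm) to $[B(\mathcal K)^n]_1^-$. For $r\in[0,1)$, $u(rT_1,\ldots,rT_n)$ is the bounded operator on $\mathcal H\otimes\mathcal E$ given by substituting $rT_i$ in the standard representation (norm-convergent series in $k$). $u(0)$ is the constant function $I\otimes A_{(0)}$, and $\|g\|_\infty:=\sup\{\|g(X)\|:X\in[B(\mathcal K)^n]_1\}$. *)

theory Defs
  imports "HOL-Analysis.Analysis"
begin

section \<open>Complex Hilbert spaces\<close>

class scaleC =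
  fixes scaleC :: "complex \<Rightarrow> 'a \<Rightarrow> 'a"  (infixr "*\<^sub>C" 75)

class complex_vector = scaleC + real_vector +
  assumes scaleC_add_right: "c *\<^sub>C (x + y) = c *\<^sub>C x + c *\<^sub>C y"
    and scaleC_add_left: "(c + d) *\<^sub>C x = c *\<^sub>C x + d *\<^sub>C x"
    and scaleC_scaleC: "c *\<^sub>C (d *\<^sub>C x) = (c * d) *\<^sub>C x"
    and scaleC_of_real: "complex_of_real r *\<^sub>C x = r *\<^sub>R x"

global_interpretation complex_vector:
  vector_space "scaleC :: complex \<Rightarrow> 'a \<Rightarrow> 'a::complex_vector"
  defines cspan = complex_vector.span
proof
  show "1 *\<^sub>C x = x" for x :: 'a
    using scaleC_of_real[of 1 x] by simp
qed (simp_all add: scaleC_add_right scaleC_add_left scaleC_scaleC)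

text \<open>The underlying real inner product, hence also the norm and the topology, is the one of
  the library class; the complex inner product is linear in its first argument.\<close>

class complex_inner = complex_vector + real_inner +
  fixes cinner :: "'a \<Rightarrow> 'a \<Rightarrow> complex"
  assumes cinner_commute: "cinner x y = cnj (cinner y x)"
    and cinner_add_left: "cinner (x + y) z = cinner x z + cinner y z"
    and cinner_scaleC_left: "cinner (c *\<^sub>C x) y = c * cinner x y"
    and Re_cinner: "Re (cinner x y) = inner x y"

class chilbert_space = complex_inner + complete_space

subclass (in chilbert_space) banach ..

lemma cinner_self: "cinner x x = complex_of_real ((norm x)\<^sup>2)"
  for x :: "'a::complex_inner"
proof (rule complex_eqI)
  show "Re (cinner x x) = Re (complex_of_real ((norm x)\<^sup>2))"
    by (simp add: Re_cinner dot_square_norm)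
  have "Im (cinner x x) = - Im (cinner x x)"
    using arg_cong[OF cinner_commute[of x x], of Im] by simp
  then show "Im (cinner x x) = Im (complex_of_real ((norm x)\<^sup>2))" by simp
qed

lemma cinner_scaleC_right: "cinner x (c *\<^sub>C y) = cnj c * cinner x y"
  for x :: "'a::complex_inner"
  by (metis cinner_commute cinner_scaleC_left complex_cnj_mult)

lemma norm_scaleC: "norm (c *\<^sub>C x) = cmod c * norm x"
  for x :: "'a::complex_inner"
proof -
  have "complex_of_real ((norm (c *\<^sub>C x))\<^sup>2) = (c * cnj c) * complex_of_real ((norm x)\<^sup>2)"
    unfolding cinner_self[symmetric] by (simp add: cinner_scaleC_left cinner_scaleC_right)
  also have "\<dots> = complex_of_real ((cmod c * norm x)\<^sup>2)"
    by (simp only: complex_norm_square[symmetric] of_real_mult[symmetric] power_mult_distrib)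
  finally have "(norm (c *\<^sub>C x))\<^sup>2 = (cmod c * norm x)\<^sup>2"
    by (simp only: of_real_eq_iff)
  then show ?thesis by (simp add: power2_eq_iff_nonneg)
qed

lemma scaleR_scaleC: "r *\<^sub>R (c *\<^sub>C x) = c *\<^sub>C (r *\<^sub>R x)"
  for x :: "'a::complex_vector"
  by (simp add: scaleC_of_real[symmetric] scaleC_scaleC mult.commute)

lemma bounded_linear_scaleC: "bounded_linear (\<lambda>x::'a::complex_inner. c *\<^sub>C x)"
  by (rule bounded_linear_intro[of _ "cmod c"])
     (simp_all add: scaleC_add_right scaleR_scaleC norm_scaleC mult.commute)

text \<open>Orthogonal projection onto a closed subspace \<open>M\<close>.\<close>

definition orth_proj :: "'a::chilbert_space set \<Rightarrow> 'a \<Rightarrow> 'a" where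
  "orth_proj M x = (THE p. p \<in> M \<and> (\<forall>m\<in>M. cinner (x - p) m = 0))"


section \<open>Bounded complex-linear operators\<close>

typedef (overloaded) ('a::complex_inner, 'b::complex_inner) cblinfun =
  "{f :: 'a \<Rightarrow>\<^sub>L 'b. \<forall>c x. blinfun_apply f (c *\<^sub>C x) = c *\<^sub>C blinfun_apply f x}"
  by (rule exI[of _ 0]) (simp add: complex_vector.scale_zero_right)

setup_lifting type_definition_cblinfun

instantiation cblinfun :: (complex_inner, complex_inner) real_normed_vector
begin

lift_definition zero_cblinfun :: "('a, 'b) cblinfun" is 0
  by (simp add: complex_vector.scale_zero_right)
lift_definition plus_cblinfun :: "('a, 'b) cblinfun \<Rightarrow> ('a, 'b) cblinfun \<Rightarrow> ('a, 'b) cblinfun" is "(+)"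
  by (simp add: blinfun.add_left scaleC_add_right)
lift_definition minus_cblinfun :: "('a, 'b) cblinfun \<Rightarrow> ('a, 'b) cblinfun \<Rightarrow> ('a, 'b) cblinfun" is "(-)"
  by (simp add: blinfun.diff_left complex_vector.scale_right_diff_distrib)
lift_definition uminus_cblinfun :: "('a, 'b) cblinfun \<Rightarrow> ('a, 'b) cblinfun" is uminus
  by (simp add: blinfun.minus_left complex_vector.scale_minus_right)
lift_definition scaleR_cblinfun :: "real \<Rightarrow> ('a, 'b) cblinfun \<Rightarrow> ('a, 'b) cblinfun" is scaleR
  by (simp add: blinfun.scaleR_left scaleR_scaleC)
lift_definition norm_cblinfun :: "('a, 'b) cblinfun \<Rightarrow> real" is norm .
definition sgn_cblinfun :: "('a, 'b) cblinfun \<Rightarrow> ('a, 'b) cblinfun"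
  where "sgn_cblinfun A = inverse (norm A) *\<^sub>R A"
definition dist_cblinfun :: "('a, 'b) cblinfun \<Rightarrow> ('a, 'b) cblinfun \<Rightarrow> real"
  where "dist_cblinfun A B = norm (A - B)"
definition uniformity_cblinfun :: "(('a, 'b) cblinfun \<times> ('a, 'b) cblinfun) filter"
  where "uniformity_cblinfun = (INF e\<in>{0<..}. principal {(A, B). dist A B < e})"
definition open_cblinfun :: "('a, 'b) cblinfun set \<Rightarrow> bool"
  where "open_cblinfun S = (\<forall>A\<in>S. \<forall>\<^sub>F (A', B) in uniformity. A' = A \<longrightarrow> B \<in> S)"

instance
proof
  fix A B C :: "('a, 'b) cblinfun" and r s :: real
  show "A + B + C = A + (B + C)" by transfer simp
  show "A + B = B + A" by transfer simp
  show "0 + A = A" by transfer simp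
  show "- A + A = 0" by transfer simp
  show "A - B = A + - B" by transfer simp
  show "r *\<^sub>R (A + B) = r *\<^sub>R A + r *\<^sub>R B" by transfer (rule scaleR_add_right)
  show "(r + s) *\<^sub>R A = r *\<^sub>R A + s *\<^sub>R A" by transfer (rule scaleR_add_left)
  show "r *\<^sub>R s *\<^sub>R A = (r * s) *\<^sub>R A" by transfer simp
  show "1 *\<^sub>R A = A" by transfer simp
  show "norm A = 0 \<longleftrightarrow> A = 0" by transfer simp
  show "norm (A + B) \<le> norm A + norm B" by transfer (rule norm_triangle_ineq)
  show "norm (r *\<^sub>R A) = \<bar>r\<bar> * norm A" by transfer simp
qed (simp_all add: sgn_cblinfun_def dist_cblinfun_def uniformity_cblinfun_def open_cblinfun_def)

end

lift_definition cblinfun_apply :: "('a::complex_inner, 'b::complex_inner) cblinfun \<Rightarrow> 'a \<Rightarrow> 'b"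
  (infixr "*\<^sub>V" 70) is blinfun_apply .

instantiation cblinfun :: (complex_inner, complex_inner) complex_vector
begin

lift_definition scaleC_cblinfun :: "complex \<Rightarrow> ('a, 'b) cblinfun \<Rightarrow> ('a, 'b) cblinfun"
  is "\<lambda>c f. Blinfun (\<lambda>x. c *\<^sub>C x) o\<^sub>L f"
  by (simp add: bounded_linear_Blinfun_apply[OF bounded_linear_scaleC] scaleC_scaleC mult.commute)

instance
proof
  note * = bounded_linear_Blinfun_apply[OF bounded_linear_scaleC]
  fix A B :: "('a, 'b) cblinfun" and c d :: complex and r :: real
  show "c *\<^sub>C (A + B) = c *\<^sub>C A + c *\<^sub>C B"
    by transfer (rule blinfun_eqI, simp add: * blinfun.add_left scaleC_add_right)
  show "(c + d) *\<^sub>C A = c *\<^sub>C A + d *\<^sub>C A"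
    by transfer (rule blinfun_eqI, simp add: * blinfun.add_left scaleC_add_left)
  show "c *\<^sub>C (d *\<^sub>C A) = (c * d) *\<^sub>C A"
    by transfer (rule blinfun_eqI, simp add: * scaleC_scaleC)
  show "complex_of_real r *\<^sub>C A = r *\<^sub>R A"
    by transfer (rule blinfun_eqI, simp add: * blinfun.scaleR_left scaleC_of_real)
qed

end

lemma cblinfun_apply_scaleC: "(c *\<^sub>C A) *\<^sub>V x = c *\<^sub>C (A *\<^sub>V x)"
  by transfer (simp add: bounded_linear_Blinfun_apply[OF bounded_linear_scaleC])

lemma norm_cblinfun_eq: "norm A = onorm (\<lambda>x. A *\<^sub>V x)"
  by transfer (simp add: norm_blinfun.rep_eq)

instance cblinfun :: (complex_inner, chilbert_space) banach
proof
  fix X :: "nat \<Rightarrow> ('a, 'b) cblinfun"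
  assume "Cauchy X"
  have dist_Rep: "dist (Rep_cblinfun A) (Rep_cblinfun B) = dist A B" for A B :: "('a, 'b) cblinfun"
    by (simp add: dist_norm norm_cblinfun.rep_eq minus_cblinfun.rep_eq)
  from \<open>Cauchy X\<close> have "Cauchy (\<lambda>n. Rep_cblinfun (X n))"
    by (simp add: Cauchy_def dist_Rep)
  then obtain L where L: "(\<lambda>n. Rep_cblinfun (X n)) \<longlonglongrightarrow> L"
    by (auto simp: convergent_eq_Cauchy[symmetric])
  have app: "(\<lambda>n. blinfun_apply (Rep_cblinfun (X n)) x) \<longlonglongrightarrow> blinfun_apply L x" for x
    using L by (intro tendsto_intros)
  have "blinfun_apply L (c *\<^sub>C x) = c *\<^sub>C blinfun_apply L x" for c x
  proof (rule LIMSEQ_unique[OF app])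
    have "(\<lambda>n. c *\<^sub>C blinfun_apply (Rep_cblinfun (X n)) x) \<longlonglongrightarrow> c *\<^sub>C blinfun_apply L x"
      by (rule bounded_linear.tendsto[OF bounded_linear_scaleC app])
    moreover have "blinfun_apply (Rep_cblinfun (X n)) (c *\<^sub>C x)
        = c *\<^sub>C blinfun_apply (Rep_cblinfun (X n)) x" for n
      using Rep_cblinfun[of "X n"] by simp
    ultimately show "(\<lambda>n. blinfun_apply (Rep_cblinfun (X n)) (c *\<^sub>C x)) \<longlonglongrightarrow> c *\<^sub>C blinfun_apply L x"
      by simp
  qed
  then have Rep_Abs: "Rep_cblinfun (Abs_cblinfun L) = L"
    by (simp add: Abs_cblinfun_inverse)
  from L have "X \<longlonglongrightarrow> Abs_cblinfun L"
    unfolding lim_sequentially by (simp add: dist_Rep[symmetric] Rep_Abs)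
  then show "convergent X" by (rule convergentI)
qed

lift_definition id_cblinfun :: "('a::complex_inner, 'a) cblinfun" is id_blinfun
  by simp

lift_definition cblinfun_compose ::
  "('b::complex_inner, 'c::complex_inner) cblinfun \<Rightarrow> ('a::complex_inner, 'b) cblinfun \<Rightarrow> ('a, 'c) cblinfun"
  (infixl "o\<^sub>C\<^sub>L" 67) is blinfun_compose
  by simp

text \<open>The adjoint exists, and is unique, by the Riesz representation theorem.\<close>

definition adj :: "('a::chilbert_space, 'b::chilbert_space) cblinfun \<Rightarrow> ('b, 'a) cblinfun" where
  "adj A = (THE B. \<forall>x y. cinner (A *\<^sub>V x) y = cinner x (B *\<^sub>V y))"

definition isometry :: "('a::chilbert_space, 'b::chilbert_space) cblinfun \<Rightarrow> bool" where
  "isometry V \<longleftrightarrow> (\<forall>x. norm (V *\<^sub>V x) = norm x)"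


section \<open>Hilbert space tensor products\<close>

text \<open>\<open>hilbert_tensor t\<close>: the type \<open>'p\<close> together with \<open>t x y = x \<otimes> y\<close> is a realisation of the
  Hilbert tensor product of \<open>'a\<close> and \<open>'b\<close>, that is, of the completion of the algebraic tensor
  product with respect to \<open>\<langle>x \<otimes> y, x' \<otimes> y'\<rangle> = \<langle>x, x'\<rangle> \<langle>y, y'\<rangle>\<close>.  Any two
  realisations are related by a unique unitary that respects the elementary tensors.\<close>

definition hilbert_tensor ::
  "('a::chilbert_space \<Rightarrow> 'b::chilbert_space \<Rightarrow> 'p::chilbert_space) \<Rightarrow> bool" where
  "hilbert_tensor t \<longleftrightarrow>
     (\<forall>x x' y. t (x + x') y = t x y + t x' y) \<and>
     (\<forall>x y y'. t x (y + y') = t x y + t x y') \<and>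
     (\<forall>c x y. t (c *\<^sub>C x) y = c *\<^sub>C t x y \<and> t x (c *\<^sub>C y) = c *\<^sub>C t x y) \<and>
     (\<forall>x x' y y'. cinner (t x y) (t x' y') = cinner x x' * cinner y y') \<and>
     closure (cspan {t x y | x y. True}) = UNIV"

text \<open>\<open>A \<otimes> B\<close>, the unique bounded operator with \<open>(A \<otimes> B) (x \<otimes> y) = A x \<otimes> B y\<close>.\<close>

definition op_tensor ::
  "('a::chilbert_space \<Rightarrow> 'b::chilbert_space \<Rightarrow> 'p::chilbert_space) \<Rightarrow>
   ('a, 'a) cblinfun \<Rightarrow> ('b, 'b) cblinfun \<Rightarrow> ('p, 'p) cblinfun" where
  "op_tensor t A B = (THE C. \<forall>x y. C *\<^sub>V t x y = t (A *\<^sub>V x) (B *\<^sub>V y))"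


section \<open>Operator tuples\<close>

text \<open>The generators of the free semigroup are indexed by a finite type \<open>'n\<close>, so its elements
  are the lists over \<open>'n\<close>, with \<open>[]\<close> as the identity.\<close>

type_synonym ('n, 'a) op_tuple = "(('a, 'a) cblinfun, 'n) vec"

definition op_word :: "('n::finite, 'a::complex_inner) op_tuple \<Rightarrow> 'n list \<Rightarrow> ('a, 'a) cblinfun" where
  "op_word T \<alpha> = foldr (\<lambda>i S. T $ i o\<^sub>C\<^sub>L S) \<alpha> id_cblinfun"

definition row_ball :: "('n::finite, 'a::chilbert_space) op_tuple set" where
  "row_ball = {X. norm (\<Sum>i\<in>UNIV. X $ i o\<^sub>C\<^sub>L adj (X $ i)) < 1}"

definition row_cball :: "('n::finite, 'a::chilbert_space) op_tuple set" where
  "row_cball = {X. norm (\<Sum>i\<in>UNIV. X $ i o\<^sub>C\<^sub>L adj (X $ i)) \<le> 1}"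

text \<open>Class \<open>\<C>\<^sub>\<rho>\<close> with a dilation acting on the Hilbert space \<open>'g\<close>.  The inclusion of \<open>'h\<close> in \<open>'g\<close>
  is the isometry \<open>J\<close>.  Existence of the larger space is expressed by leaving the type \<open>'g\<close>
  arbitrary wherever membership is assumed.\<close>

definition class_C ::
  "'g::chilbert_space itself \<Rightarrow> real \<Rightarrow> ('n::finite, 'h::chilbert_space) op_tuple \<Rightarrow> bool" where
  "class_C _ \<rho> T \<longleftrightarrow>
     (\<exists>(J :: ('h, 'g) cblinfun) (V :: ('n, 'g) op_tuple).
        isometry J \<and>
        (\<forall>i. isometry (V $ i)) \<and>
        (\<forall>i j x y. i \<noteq> j \<longrightarrow> cinner (V $ i *\<^sub>V x) (V $ j *\<^sub>V y) = 0) \<and>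
        (\<forall>\<alpha> x. \<alpha> \<noteq> [] \<longrightarrow>
           J *\<^sub>V op_word T \<alpha> *\<^sub>V x
             = \<rho> *\<^sub>R orth_proj (range (\<lambda>h. J *\<^sub>V h)) (op_word V \<alpha> *\<^sub>V J *\<^sub>V x)))"


section \<open>Free holomorphic and free pluriharmonic functions\<close>

text \<open>Functions on the open ball are represented by total functions of which only the values on
  \<^const>\<open>row_ball\<close> matter.\<close>

definition hol_part ::
  "('a::chilbert_space \<Rightarrow> 'e::chilbert_space \<Rightarrow> 'p::chilbert_space) \<Rightarrow>
   ('n::finite list \<Rightarrow> ('e, 'e) cblinfun) \<Rightarrow> ('n, 'a) op_tuple \<Rightarrow> nat \<Rightarrow> ('p, 'p) cblinfun" where
  "hol_part t A X k = (\<Sum>\<alpha> | length \<alpha> = k. op_tensor t (op_word X \<alpha>) (A \<alpha>))"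

definition antihol_part ::
  "('a::chilbert_space \<Rightarrow> 'e::chilbert_space \<Rightarrow> 'p::chilbert_space) \<Rightarrow>
   ('n::finite list \<Rightarrow> ('e, 'e) cblinfun) \<Rightarrow> ('n, 'a) op_tuple \<Rightarrow> nat \<Rightarrow> ('p, 'p) cblinfun" where
  "antihol_part t B X k = (\<Sum>\<alpha> | length \<alpha> = k. op_tensor t (adj (op_word X \<alpha>)) (B \<alpha>))"

definition free_holomorphic ::
  "('k::chilbert_space \<Rightarrow> 'e::chilbert_space \<Rightarrow> 'p::chilbert_space) \<Rightarrow>
   (('n::finite, 'k) op_tuple \<Rightarrow> ('p, 'p) cblinfun) \<Rightarrow> bool" where
  "free_holomorphic t F \<longleftrightarrow>
     (\<exists>A :: 'n list \<Rightarrow> ('e, 'e) cblinfun.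
        limsup (\<lambda>k. ereal (root (2 * k)
          (norm (\<Sum>\<alpha> | length \<alpha> = k. adj (A \<alpha>) o\<^sub>C\<^sub>L A \<alpha>)))) \<le> 1 \<and>
        (\<forall>X\<in>row_ball. hol_part t A X sums F X))"

definition selfadjoint_free_pluriharmonic ::
  "('k::chilbert_space \<Rightarrow> 'e::chilbert_space \<Rightarrow> 'p::chilbert_space) \<Rightarrow>
   (('n::finite, 'k) op_tuple \<Rightarrow> ('p, 'p) cblinfun) \<Rightarrow> bool" where
  "selfadjoint_free_pluriharmonic t H \<longleftrightarrow>
     (\<exists>F. free_holomorphic t F \<and> (\<forall>X\<in>row_ball. H X = (1/2) *\<^sub>R (adj (F X) + F X)))"

definition free_pluriharmonic ::
  "('k::chilbert_space \<Rightarrow> 'e::chilbert_space \<Rightarrow> 'p::chilbert_space) \<Rightarrow>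
   (('n::finite, 'k) op_tuple \<Rightarrow> ('p, 'p) cblinfun) \<Rightarrow> bool" where
  "free_pluriharmonic t u \<longleftrightarrow>
     (\<exists>H1 H2. selfadjoint_free_pluriharmonic t H1 \<and> selfadjoint_free_pluriharmonic t H2 \<and>
        (\<forall>X\<in>row_ball. u X = H1 X + \<i> *\<^sub>C H2 X))"

definition Har_c ::
  "('k::chilbert_space \<Rightarrow> 'e::chilbert_space \<Rightarrow> 'p::chilbert_space) \<Rightarrow>
   (('n::finite, 'k) op_tuple \<Rightarrow> ('p, 'p) cblinfun) set" where
  "Har_c t = {u. free_pluriharmonic t u \<and>
     (\<exists>v. continuous_on row_cball v \<and> (\<forall>X\<in>row_ball. v X = u X))}"

text \<open>The two series of a standard representation run over the words of length \<open>k \<ge> 1\<close>.\<close>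

definition std_rep_converges ::
  "('a::chilbert_space \<Rightarrow> 'e::chilbert_space \<Rightarrow> 'p::chilbert_space) \<Rightarrow>
   ('n::finite list \<Rightarrow> ('e, 'e) cblinfun) \<Rightarrow> ('n list \<Rightarrow> ('e, 'e) cblinfun) \<Rightarrow>
   ('n, 'a) op_tuple \<Rightarrow> bool" where
  "std_rep_converges t A B X \<longleftrightarrow>
     summable (\<lambda>k. antihol_part t B X (Suc k)) \<and> summable (\<lambda>k. hol_part t A X (Suc k))"

definition std_rep ::
  "('a::chilbert_space \<Rightarrow> 'e::chilbert_space \<Rightarrow> 'p::chilbert_space) \<Rightarrow>
   ('n::finite list \<Rightarrow> ('e, 'e) cblinfun) \<Rightarrow> ('n list \<Rightarrow> ('e, 'e) cblinfun) \<Rightarrow>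
   ('n, 'a) op_tuple \<Rightarrow> ('p, 'p) cblinfun" where
  "std_rep t A B X =
     (\<Sum>k. antihol_part t B X (Suc k)) + op_tensor t id_cblinfun (A []) +
     (\<Sum>k. hol_part t A X (Suc k))"

definition ball_norm ::
  "(('n::finite, 'k::chilbert_space) op_tuple \<Rightarrow> ('p::chilbert_space, 'p) cblinfun) \<Rightarrow> ereal" where
  "ball_norm g = (SUP X\<in>row_ball. ereal (norm (g X)))"

end

theory Submission
  imports Defs
begin

text \<open>No von Neumann inequality is needed.  For countably many vectors of \<open>\<H>\<close>, let \<open>M\<close> be the closed
  subspace of the dilation space that is generated by their images under all words in the isometries
  \<open>V\<^sub>i\<close>.  It is separable and invariant under the \<open>V\<^sub>i\<close>, so it embeds in \<open>\<K>\<close>; the restrictions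
  \<open>V\<^sub>i|M\<close> become a row contraction \<open>X\<close> on \<open>\<K>\<close>, and \<open>T\<^sub>\<alpha>\<close> is \<open>\<rho>\<close> times the compression of \<open>X\<^sub>\<alpha>\<close>
  as far as these vectors can tell.  Hence \<open>u(rT)\<close> is the compression of
  \<open>\<rho> u(rX) + (1 - \<rho>) u(0)\<close>, with the same \<open>X\<close> for all \<open>r\<close>.  Countably many vectors suffice to compute
  the norms of countably many operators, so one \<open>X\<close> transfers the Cauchy criterion for the series.
  Likewise, if \<open>u(rT)\<close> were not Cauchy as \<open>r \<rightarrow> 1\<close>, sequences witnessing this would
  contradict the continuity of \<open>u\<close> at a single point \<open>X\<close> of the closed ball.\<close>

section \<open>The complex inner product\<close>

lemma cinner_add_right: "cinner x (y + z) = cinner x y + cinner x z"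
  for x :: "'a::complex_inner"
  by (metis cinner_add_left cinner_commute complex_cnj_add)

lemma cinner_scaleR_left: "cinner (r *\<^sub>R x) y = r *\<^sub>R cinner x y"
  for x :: "'a::complex_inner"
  by (simp add: scaleC_of_real[symmetric] cinner_scaleC_left scaleR_conv_of_real)

lemma cinner_scaleR_right: "cinner x (r *\<^sub>R y) = r *\<^sub>R cinner x y"
  for x :: "'a::complex_inner"
  by (simp add: scaleC_of_real[symmetric] cinner_scaleC_right scaleR_conv_of_real)

text \<open>Rotating \<open>x\<close> by the unimodular \<open>c\<close> makes the complex inner
  product real and nonnegative, which reduces the claim to the Cauchy-Schwarz inequality of the
  underlying real inner product.\<close>

lemma norm_cinner_le: "cmod (cinner x y) \<le> norm x * norm y"
  for x :: "'a::complex_inner"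
proof (cases "cinner x y = 0")
  case False
  define c where "c = cnj (cinner x y) / cmod (cinner x y)"
  have "cmod c = 1" using False by (simp add: c_def norm_divide)
  have "cinner (c *\<^sub>C x) y = complex_of_real (cmod (cinner x y))"
    using False unfolding cinner_scaleC_left c_def
    by (simp add: complex_norm_square[symmetric] mult.commute power2_eq_square)
  then have "cmod (cinner x y) = inner (c *\<^sub>C x) y"
    by (simp add: Re_cinner[symmetric])
  also have "\<dots> \<le> norm (c *\<^sub>C x) * norm y" by (rule norm_cauchy_schwarz)
  finally show ?thesis using \<open>cmod c = 1\<close> by (simp add: norm_scaleC)
qed simp

interpretation cinner: bounded_bilinear "cinner :: 'a::complex_inner \<Rightarrow> _"
  by unfold_locales
    (auto simp: cinner_add_left cinner_add_right cinner_scaleR_left cinner_scaleR_right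
      intro!: exI[of _ 1] norm_cinner_le)

lemma cinner_ext: "(\<And>z. cinner x z = cinner y z) \<Longrightarrow> x = y"
  for x :: "'a::complex_inner"
  by (metis cinner_self cinner.diff_left eq_iff_diff_eq_0 norm_eq_zero of_real_eq_0_iff power_eq_0_iff)

lemma cinner_eq_0_commute: "cinner x y = 0 \<longleftrightarrow> cinner y x = 0"
  for x :: "'a::complex_inner"
  by (metis cinner_commute complex_cnj_zero)

lemma norm_sum_cinner_orthogonal:
  fixes z :: "'i \<Rightarrow> 'a::complex_inner"
  assumes "finite I" "\<And>i j. i \<in> I \<Longrightarrow> j \<in> I \<Longrightarrow> i \<noteq> j \<Longrightarrow> cinner (z i) (z j) = 0"
  shows "(norm (\<Sum>i\<in>I. z i))\<^sup>2 = (\<Sum>i\<in>I. (norm (z i))\<^sup>2)"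
  using assms
  by (intro norm_sum_Pythagorean) (auto simp: pairwise_def orthogonal_def Re_cinner[symmetric])


section \<open>Projections, the Riesz representation theorem and adjoints\<close>

lemma parallelogram_law:
  "(norm (x + y))\<^sup>2 + (norm (x - y))\<^sup>2 = 2 * (norm x)\<^sup>2 + 2 * (norm y)\<^sup>2"
  for x y :: "'a::real_inner"
  by (simp add: power2_norm_eq_inner inner_simps inner_commute)

text \<open>A minimising sequence is Cauchy by the parallelogram law; completeness of the space and
  closedness of \<open>M\<close> give its limit in \<open>M\<close>.\<close>

lemma closest_point_exists:
  fixes M :: "'a::{real_inner,complete_space} set"
  assumes "closed M" "convex M" "M \<noteq> {}"
  obtains p where "p \<in> M" "\<And>m. m \<in> M \<Longrightarrow> dist x p \<le> dist x m"
proof -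
  define d where "d = infdist x M"
  have d_le: "d \<le> dist x m" if "m \<in> M" for m
    using that by (simp add: d_def infdist_le)
  have "\<exists>m\<in>M. dist x m < d + inverse (real (Suc n))" for n
  proof (rule ccontr)
    assume "\<not> ?thesis"
    then have "d + inverse (real (Suc n)) \<le> (INF m\<in>M. dist x m)"
      using assms(3) by (intro cINF_greatest) (auto simp: not_less)
    then show False using assms(3) by (simp add: d_def infdist_def)
  qed
  then obtain m where m: "\<And>n. m n \<in> M" "\<And>n. dist x (m n) < d + inverse (real (Suc n))"
    by metis
  have d0: "d \<ge> 0" by (simp add: d_def infdist_nonneg)
  have dist_m: "(dist (m i) (m j))\<^sup>2 \<le> 2 * (dist x (m i))\<^sup>2 + 2 * (dist x (m j))\<^sup>2 - 4 * d\<^sup>2" for i j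
  proof -
    \<comment> \<open>By convexity the midpoint of \<open>m i\<close> and \<open>m j\<close> is in
      \<open>M\<close>, so its distance to \<open>x\<close> is at least \<open>d\<close>. The
      parallelogram law turns this lower bound into an upper bound for the distance of
      \<open>m i\<close> and \<open>m j\<close>.\<close>
    have "(1/2) *\<^sub>R m i + (1/2) *\<^sub>R m j \<in> M"
      using assms(2) m(1) by (intro convexD) auto
    then have "d \<le> norm (x - ((1/2) *\<^sub>R m i + (1/2) *\<^sub>R m j))"
      using d_le by (simp add: dist_norm)
    also have "x - ((1/2) *\<^sub>R m i + (1/2) *\<^sub>R m j) = (1/2) *\<^sub>R ((x - m i) + (x - m j))"
      by (simp add: algebra_simps scaleR_2[symmetric])
    finally have "2 * d \<le> norm ((x - m i) + (x - m j))" by simp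
    then have "(2 * d)\<^sup>2 \<le> (norm ((x - m i) + (x - m j)))\<^sup>2"
      using d0 by (intro power_mono) auto
    moreover have "dist (m i) (m j) = norm ((x - m i) - (x - m j))"
      by (simp add: dist_norm norm_minus_commute)
    ultimately show ?thesis
      using parallelogram_law[of "x - m i" "x - m j"] by (simp add: dist_norm power_mult_distrib)
  qed
  have lim_d: "(\<lambda>n. dist x (m n)) \<longlonglongrightarrow> d"
  proof (rule tendsto_sandwich[of "\<lambda>_. d" _ _ "\<lambda>n. d + inverse (real (Suc n))"])
    show "(\<lambda>n. d + inverse (real (Suc n))) \<longlonglongrightarrow> d"
      using tendsto_add[OF tendsto_const LIMSEQ_inverse_real_of_nat, of d] by simp
  qed (simp_all add: m d_le less_imp_le del: of_nat_Suc)
  have "Cauchy m"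
  proof (rule metric_CauchyI)
    fix e :: real assume "e > 0"
    have "(\<lambda>n. 2 * (dist x (m n))\<^sup>2 - 2 * d\<^sup>2) \<longlonglongrightarrow> 2 * d\<^sup>2 - 2 * d\<^sup>2"
      by (intro tendsto_intros lim_d)
    then have "\<forall>\<^sub>F n in sequentially. 2 * (dist x (m n))\<^sup>2 - 2 * d\<^sup>2 < e\<^sup>2 / 2"
      using \<open>e > 0\<close> by (intro order_tendstoD(2)[of _ "2 * d\<^sup>2 - 2 * d\<^sup>2"]) auto
    then obtain N where N: "\<And>n. n \<ge> N \<Longrightarrow> 2 * (dist x (m n))\<^sup>2 - 2 * d\<^sup>2 < e\<^sup>2 / 2"
      by (auto simp: eventually_sequentially)
    have "dist (m i) (m j) < e" if "i \<ge> N" "j \<ge> N" for i j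
    proof -
      have "(dist (m i) (m j))\<^sup>2 < e\<^sup>2"
        using dist_m[of i j] N[OF that(1)] N[OF that(2)] by linarith
      then show ?thesis using \<open>e > 0\<close> by (simp add: power_less_imp_less_base)
    qed
    then show "\<exists>N. \<forall>i\<ge>N. \<forall>j\<ge>N. dist (m i) (m j) < e" by blast
  qed
  then obtain p where p: "m \<longlonglongrightarrow> p"
    by (auto simp: Cauchy_convergent_iff convergent_def)
  have "p \<in> M" using assms(1) m(1) p by (rule closed_sequentially)
  moreover have "dist x p = d"
    using LIMSEQ_unique[OF tendsto_dist[OF tendsto_const p] lim_d] .
  ultimately show thesis using that d_le by metis
qed

text \<open>The closest point works: a real variation along \<open>m\<close> shows that the real
  part of the inner product vanishes, and replacing \<open>m\<close> by its multiple by
  \<open>\<i>\<close> gives the imaginary part.\<close>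

lemma orth_proj_exists:
  fixes M :: "'a::chilbert_space set"
  assumes "closed M" and sub: "complex_vector.subspace M"
  obtains p where "p \<in> M" "\<And>m. m \<in> M \<Longrightarrow> cinner (x - p) m = 0"
proof -
  have add: "a + b \<in> M" if "a \<in> M" "b \<in> M" for a b
    using sub that by (rule complex_vector.subspace_add)
  have scC: "c *\<^sub>C a \<in> M" if "a \<in> M" for a c
    using sub that by (rule complex_vector.subspace_scale)
  have scR: "r *\<^sub>R a \<in> M" if "a \<in> M" for a r
    using scC[OF that] by (metis scaleC_of_real)
  have "convex M" by (auto simp: convex_def add scR)
  moreover have "M \<noteq> {}" using complex_vector.subspace_0[OF sub] by auto
  ultimately obtain p where p: "p \<in> M" "\<And>m. m \<in> M \<Longrightarrow> dist x p \<le> dist x m"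
    using closest_point_exists assms(1) by metis
  have inner0: "inner (x - p) m = 0" if "m \<in> M" for m
  proof (cases "m = 0")
    case False
    \<comment> \<open>This \<open>t\<close> minimises the norm of
      \<open>(x - p) - t *\<^sub>R m\<close> over the reals.\<close>
    define t where "t = inner (x - p) m / (norm m)\<^sup>2"
    have "norm (x - p) \<le> norm ((x - p) - t *\<^sub>R m)"
      using p(2)[OF add[OF p(1) scR[OF that]], of t] by (simp add: dist_norm algebra_simps)
    then have "(norm (x - p))\<^sup>2 \<le> (norm ((x - p) - t *\<^sub>R m))\<^sup>2"
      by (rule power_mono) simp
    also have "\<dots> = (norm (x - p))\<^sup>2 - 2 * t * inner (x - p) m + t\<^sup>2 * (norm m)\<^sup>2"
      by (simp only: power2_norm_eq_inner) (simp add: inner_simps inner_commute power2_eq_square)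
    also have "t\<^sup>2 * (norm m)\<^sup>2 = t * inner (x - p) m"
      using False by (simp add: t_def power2_eq_square)
    finally have "t * inner (x - p) m \<le> 0" by simp
    then have "(inner (x - p) m)\<^sup>2 / (norm m)\<^sup>2 \<le> 0"
      by (simp add: t_def power2_eq_square)
    then show ?thesis using False by (simp add: divide_le_0_iff)
  qed simp
  have "cinner (x - p) m = 0" if "m \<in> M" for m
  proof (rule complex_eqI)
    show "Re (cinner (x - p) m) = Re 0" using inner0[OF that] by (simp add: Re_cinner)
    have "Re (cinner (x - p) (\<i> *\<^sub>C m)) = 0" using inner0[OF scC[OF that]] by (simp add: Re_cinner)
    then show "Im (cinner (x - p) m) = Im 0" by (simp add: cinner_scaleC_right)
  qed
  with p(1) show thesis using that by blast
qed

text \<open>The description in \<open>orth_proj\<close> determines one point: the difference of two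
  candidates lies in \<open>M\<close> and is orthogonal to \<open>M\<close>, hence to
  itself.\<close>

lemma orth_proj:
  fixes M :: "'a::chilbert_space set"
  assumes "closed M" "complex_vector.subspace M"
  shows "orth_proj M x \<in> M" "m \<in> M \<Longrightarrow> cinner (orth_proj M x) m = cinner x m"
proof -
  obtain p where p: "p \<in> M" "\<And>m. m \<in> M \<Longrightarrow> cinner (x - p) m = 0"
    using orth_proj_exists[OF assms] by blast
  have "q = p" if "q \<in> M \<and> (\<forall>m\<in>M. cinner (x - q) m = 0)" for q
  proof -
    from that have q: "q \<in> M" "\<forall>m\<in>M. cinner (x - q) m = 0" by auto
    have "q - p \<in> M" using q(1) p(1) by (rule complex_vector.subspace_diff[OF assms(2)])
    then have "cinner (x - p) (q - p) = 0" "cinner (x - q) (q - p) = 0" using p(2) q(2) by auto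
    then have "cinner ((x - p) - (x - q)) (q - p) = 0"
      by (simp only: cinner.diff_left[of "x - p"]) simp
    then show ?thesis by (simp add: cinner_self)
  qed
  then have "orth_proj M x = p"
    unfolding orth_proj_def using p by (intro the_equality) blast+
  with p show "orth_proj M x \<in> M" "m \<in> M \<Longrightarrow> cinner (orth_proj M x) m = cinner x m"
    by (auto simp: cinner.diff_left)
qed

text \<open>A vector \<open>y\<close> orthogonal to the kernel of \<open>f\<close> represents
  \<open>f\<close> up to a scalar, because every \<open>w\<close> differs from a multiple of
  \<open>y\<close> by an element of the kernel.\<close>

lemma riesz_representation:
  fixes f :: "'a::chilbert_space \<Rightarrow> complex"
  assumes "bounded_linear f" and scale: "\<And>c x. f (c *\<^sub>C x) = c * f x"
  obtains z where "\<And>x. f x = cinner x z"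
proof (cases "\<forall>x. f x = 0")
  case True
  then show thesis using that[of 0] by (simp add: cinner.zero_right)
next
  case False
  then obtain x where x: "f x \<noteq> 0" by blast
  interpret f: bounded_linear f by fact
  define M where "M = {x. f x = 0}"
  have "closed M" unfolding M_def
    by (intro closed_Collect_eq continuous_intros f.continuous_on)
  moreover have sub: "complex_vector.subspace M"
    by (intro complex_vector.subspaceI) (simp_all add: M_def f.zero f.add scale)
  ultimately obtain p where p: "p \<in> M" "\<And>m. m \<in> M \<Longrightarrow> cinner (x - p) m = 0"
    using orth_proj_exists by metis
  define y where "y = x - p"
  have fy: "f y \<noteq> 0" using x p(1) by (simp add: y_def M_def f.diff)
  then have "y \<noteq> 0" using f.zero by auto
  \<comment> \<open>The conjugate is there because \<open>cinner\<close> is conjugate-linear in its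
    second argument.\<close>
  define z where "z = cnj (f y / cinner y y) *\<^sub>C y"
  have "f w = cinner w z" for w
  proof -
    have "w - (f w / f y) *\<^sub>C y \<in> M" using fy by (simp add: M_def f.diff scale)
    then have "cinner y (w - (f w / f y) *\<^sub>C y) = 0" using p(2) by (simp add: y_def)
    then have "cinner w y = (f w / f y) * cinner y y"
      by (subst (asm) cinner_eq_0_commute) (simp add: cinner.diff_left cinner_scaleC_left)
    then show ?thesis using fy \<open>y \<noteq> 0\<close>
      by (simp add: z_def cinner_scaleC_right cinner_self)
  qed
  then show thesis by (rule that)
qed

section \<open>Bounded complex-linear operators and the existence of adjoints\<close>

lemma cblinfun_eqI: "(\<And>x. A *\<^sub>V x = B *\<^sub>V x) \<Longrightarrow> A = B"
  by transfer (rule blinfun_eqI)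

interpretation cblinfun: bounded_bilinear "(*\<^sub>V)"
proof
  show "(A + B) *\<^sub>V x = A *\<^sub>V x + B *\<^sub>V x" for A B :: "('a, 'b) cblinfun" and x
    by transfer (rule blinfun.add_left)
  show "A *\<^sub>V (x + y) = A *\<^sub>V x + A *\<^sub>V y" for A :: "('a, 'b) cblinfun" and x y
    by transfer (rule blinfun.add_right)
  show "(r *\<^sub>R A) *\<^sub>V x = r *\<^sub>R (A *\<^sub>V x)" for A :: "('a, 'b) cblinfun" and r x
    by transfer (rule blinfun.scaleR_left)
  show "A *\<^sub>V (r *\<^sub>R x) = r *\<^sub>R (A *\<^sub>V x)" for A :: "('a, 'b) cblinfun" and r x
    by transfer (rule blinfun.scaleR_right)
  have "norm (A *\<^sub>V x) \<le> norm A * norm x" for A :: "('a, 'b) cblinfun" and x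
    by transfer (rule norm_blinfun)
  then show "\<exists>K. \<forall>(A::('a, 'b) cblinfun) x. norm (A *\<^sub>V x) \<le> norm A * norm x * K"
    by (intro exI[of _ 1]) simp
qed

lemma norm_cblinfun: "norm (A *\<^sub>V x) \<le> norm A * norm x"
  by transfer (rule norm_blinfun)

lemma norm_cblinfun_bound: "0 \<le> b \<Longrightarrow> (\<And>x. norm (A *\<^sub>V x) \<le> b * norm x) \<Longrightarrow> norm A \<le> b"
  by transfer (rule norm_blinfun_bound)

lemma cblinfun_scaleC_right: "A *\<^sub>V (c *\<^sub>C x) = c *\<^sub>C (A *\<^sub>V x)"
  by transfer simp

lemma cblinfun_apply_compose [simp]: "(A o\<^sub>C\<^sub>L B) *\<^sub>V x = A *\<^sub>V (B *\<^sub>V x)"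
  by transfer simp

lemma cblinfun_apply_id [simp]: "id_cblinfun *\<^sub>V x = x"
  by transfer simp

lemma cblinfun_exists:
  fixes f :: "'a::complex_inner \<Rightarrow> 'b::complex_inner"
  assumes "\<And>x y. f (x + y) = f x + f y" "\<And>c x. f (c *\<^sub>C x) = c *\<^sub>C f x"
    and "\<And>x. norm (f x) \<le> b * norm x"
  obtains A where "\<And>x. A *\<^sub>V x = f x"
proof -
  have bl: "bounded_linear f"
    using assms by (intro bounded_linear_intro[of _ b]) (auto simp: scaleC_of_real[symmetric] mult.commute)
  have "Abs_cblinfun (Blinfun f) *\<^sub>V x = f x" for x
    by (simp add: cblinfun_apply.rep_eq Abs_cblinfun_inverse bounded_linear_Blinfun_apply[OF bl] assms(2))
  then show thesis by (rule that)
qed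

text \<open>Riesz representation of \<open>\<lambda>x. cinner (A *\<^sub>V x) y\<close> gives a
  vector \<open>g y\<close> for each \<open>y\<close>. Pairing with test vectors shows that
  \<open>g\<close> is linear, and the Cauchy-Schwarz inequality at \<open>g y\<close> that it is
  bounded. Uniqueness then identifies it with \<open>adj A\<close>.\<close>

lemma cinner_adj: "cinner (A *\<^sub>V x) y = cinner x (adj A *\<^sub>V y)"
proof -
  have "\<exists>z. \<forall>x. cinner (A *\<^sub>V x) y = cinner x z" for y
  proof -
    have "bounded_linear (\<lambda>x. cinner (A *\<^sub>V x) y)"
      by (intro bounded_linear_compose[OF cinner.bounded_linear_left cblinfun.bounded_linear_right])
    then show ?thesis
      using riesz_representation[of "\<lambda>x. cinner (A *\<^sub>V x) y"]
      by (simp add: cblinfun_scaleC_right cinner_scaleC_left) blast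
  qed
  then obtain g where g: "cinner (A *\<^sub>V x) y = cinner x (g y)" for x y by metis
  have g': "cinner (g y) x = cinner y (A *\<^sub>V x)" for x y
    by (metis g cinner_commute)
  have "\<exists>B. \<forall>y. B *\<^sub>V y = g y"
  proof (rule cblinfun_exists[of g "norm A"])
    show "g (x + y) = g x + g y" for x y
      by (rule cinner_ext) (simp add: g' cinner_add_left)
    show "g (c *\<^sub>C x) = c *\<^sub>C g x" for c x
      by (rule cinner_ext) (simp add: g' cinner_scaleC_left)
    show "norm (g y) \<le> norm A * norm y" for y
    proof (cases "g y = 0")
      case False
      have "(norm (g y))\<^sup>2 = cmod (cinner (A *\<^sub>V g y) y)"
        by (simp add: g cinner_self norm_power)
      also have "\<dots> \<le> norm (A *\<^sub>V g y) * norm y" by (rule norm_cinner_le)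
      also have "\<dots> \<le> norm A * norm (g y) * norm y" by (intro mult_right_mono norm_cblinfun) simp
      finally show ?thesis using False by (simp add: power2_eq_square)
    qed simp
  qed blast
  then obtain B where B: "B *\<^sub>V y = g y" for y by blast
  have "B' = B" if "\<forall>x y. cinner (A *\<^sub>V x) y = cinner x (B' *\<^sub>V y)" for B'
  proof (rule cblinfun_eqI, rule cinner_ext)
    show "cinner (B' *\<^sub>V x) z = cinner (B *\<^sub>V x) z" for x z
      using arg_cong[OF that[rule_format, of z x], of cnj] by (simp add: B g' flip: cinner_commute)
  qed
  then have "adj A = B"
    unfolding adj_def using g B by (intro the_equality) auto
  then show ?thesis by (simp add: B g)
qed

lemma cinner_adj_left: "cinner (adj A *\<^sub>V x) y = cinner x (A *\<^sub>V y)"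
  using arg_cong[OF cinner_adj[of A y x], of cnj] by (simp flip: cinner_commute)

section \<open>Tensor products of operators\<close>

text \<open>\<open>G\<close> is a densely defined linear relation, given by pairs rather than by a
  function so that a value may be prescribed through any representation of its argument. The bound,
  applied to differences, makes the relation single-valued. The extension is the closure of this
  graph, which is \<open>R\<close>.\<close>

lemma cblinfun_extension_by_density:
  fixes G :: "('a::complex_inner \<times> 'b::chilbert_space) set"
  assumes add: "\<And>a b a' b'. (a, b) \<in> G \<Longrightarrow> (a', b') \<in> G \<Longrightarrow> (a + a', b + b') \<in> G"
    and scale: "\<And>c a b. (a, b) \<in> G \<Longrightarrow> (c *\<^sub>C a, c *\<^sub>C b) \<in> G"
    and bound: "\<And>a b. (a, b) \<in> G \<Longrightarrow> norm b \<le> d * norm a"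
    and dense: "closure (fst ` G) = UNIV"
  obtains C where "\<And>a b. (a, b) \<in> G \<Longrightarrow> C *\<^sub>V a = b"
proof -
  define R where "R z w \<longleftrightarrow> (\<exists>a b. (\<forall>n::nat. (a n, b n) \<in> G) \<and> a \<longlonglongrightarrow> z \<and> b \<longlonglongrightarrow> w)" for z w
  have diff: "(a - a', b - b') \<in> G" if "(a, b) \<in> G" "(a', b') \<in> G" for a b a' b'
    using add[OF that(1) scale[OF that(2), of "-1"]]
    by (simp add: complex_vector.scale_minus_left)
  have R_add: "R (z + z') (w + w')" if "R z w" "R z' w'" for z w z' w'
  proof -
    from that(1) obtain a b where ab: "\<And>n::nat. (a n, b n) \<in> G" "a \<longlonglongrightarrow> z" "b \<longlonglongrightarrow> w"
      unfolding R_def by blast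
    from that(2) obtain a' b' where ab': "\<And>n::nat. (a' n, b' n) \<in> G" "a' \<longlonglongrightarrow> z'" "b' \<longlonglongrightarrow> w'"
      unfolding R_def by blast
    show ?thesis unfolding R_def
      by (rule exI[of _ "\<lambda>n. a n + a' n"], rule exI[of _ "\<lambda>n. b n + b' n"])
        (intro conjI allI add ab ab' tendsto_add)
  qed
  have R_scale: "R (c *\<^sub>C z) (c *\<^sub>C w)" if "R z w" for c z w
  proof -
    from that obtain a b where ab: "\<And>n::nat. (a n, b n) \<in> G" "a \<longlonglongrightarrow> z" "b \<longlonglongrightarrow> w"
      unfolding R_def by blast
    show ?thesis unfolding R_def
      by (rule exI[of _ "\<lambda>n. c *\<^sub>C a n"], rule exI[of _ "\<lambda>n. c *\<^sub>C b n"])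
        (intro conjI allI scale ab bounded_linear.tendsto[OF bounded_linear_scaleC])
  qed
  have R_bound: "norm w \<le> d * norm z" if "R z w" for z w
  proof -
    from that obtain a b where ab: "\<And>n::nat. (a n, b n) \<in> G" "a \<longlonglongrightarrow> z" "b \<longlonglongrightarrow> w"
      unfolding R_def by blast
    show ?thesis
      by (rule LIMSEQ_le[OF tendsto_norm[OF ab(3)] tendsto_mult_left[OF tendsto_norm[OF ab(2)]]])
        (use bound[OF ab(1)] in auto)
  qed
  have R_unique: "w = w'" if "R z w" "R z w'" for z w w'
    using R_bound[OF R_add[OF that(1) R_scale[OF that(2), of "-1"]]]
    by (simp add: complex_vector.scale_minus_left)
  have "\<exists>w. R z w" for z
  proof -
    obtain a where a: "\<And>n. a n \<in> fst ` G" "a \<longlonglongrightarrow> z"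
      using dense closure_sequential[of z "fst ` G"] by auto
    then have "\<forall>n. \<exists>b. (a n, b) \<in> G" by force
    then obtain b where b: "\<And>n. (a n, b n) \<in> G" by metis
    have "Cauchy b"
    proof (rule metric_CauchyI)
      fix e :: real assume "e > 0"
      have "Cauchy a" using a(2) by (rule LIMSEQ_imp_Cauchy)
      \<comment> \<open>The denominator is positive whatever the sign of \<open>d\<close>.\<close>
      then obtain N where N: "\<And>i j. i \<ge> N \<Longrightarrow> j \<ge> N \<Longrightarrow> dist (a i) (a j) < e / (\<bar>d\<bar> + 1)"
        using \<open>e > 0\<close> unfolding Cauchy_def by (metis abs_ge_zero add_nonneg_pos divide_pos_pos zero_less_one)
      have "dist (b i) (b j) < e" if "i \<ge> N" "j \<ge> N" for i j
      proof -
        have "dist (b i) (b j) \<le> d * dist (a i) (a j)"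
          using bound[OF diff[OF b b]] by (simp add: dist_norm)
        also have "\<dots> \<le> (\<bar>d\<bar> + 1) * dist (a i) (a j)" by (intro mult_right_mono) auto
        also have "\<dots> < e" using N[OF that] by (simp add: field_simps add_pos_nonneg)
        finally show ?thesis .
      qed
      then show "\<exists>N. \<forall>i\<ge>N. \<forall>j\<ge>N. dist (b i) (b j) < e" by blast
    qed
    then obtain w where "b \<longlonglongrightarrow> w" by (auto simp: Cauchy_convergent_iff convergent_def)
    with a(2) b show ?thesis unfolding R_def by blast
  qed
  then obtain f where f: "\<And>z. R z (f z)" by metis
  obtain C where C: "\<And>z. C *\<^sub>V z = f z"
  proof (rule cblinfun_exists[of f d])
    show "f (x + y) = f x + f y" for x y by (rule R_unique[OF f R_add[OF f f]])
    show "f (c *\<^sub>C x) = c *\<^sub>C f x" for c x by (rule R_unique[OF f R_scale[OF f]])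
    show "norm (f x) \<le> d * norm x" for x by (rule R_bound[OF f])
  qed blast
  have "R a b" if "(a, b) \<in> G" for a b
    unfolding R_def using that by (intro exI[of _ "\<lambda>_. a"] exI[of _ "\<lambda>_. b"]) simp
  then have "C *\<^sub>V a = b" if "(a, b) \<in> G" for a b
    using that R_unique[OF f] by (simp add: C)
  then show thesis by (rule that)
qed

text \<open>Lists of pairs stand for elements of the algebraic tensor product. Many lists have the
  same value, so an operator acting on the entries of a list must still be shown to be well defined
  on values.\<close>

definition tensor_sum :: "('a \<Rightarrow> 'b \<Rightarrow> 'p::chilbert_space) \<Rightarrow> ('a \<times> 'b) list \<Rightarrow> 'p" where
  "tensor_sum t L = (\<Sum>(x, y)\<leftarrow>L. t x y)"

lemma tensor_sum_simps [simp]: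
  "tensor_sum t [] = 0"
  "tensor_sum t ((x, y) # L) = t x y + tensor_sum t L"
  "tensor_sum t (L @ L') = tensor_sum t L + tensor_sum t L'"
  by (simp_all add: tensor_sum_def)

context
  fixes t :: "'a::chilbert_space \<Rightarrow> 'b::chilbert_space \<Rightarrow> 'p::chilbert_space"
  assumes t: "hilbert_tensor t"
begin

lemma tensor_simps:
  "t (x + x') y = t x y + t x' y"
  "t x (y + y') = t x y + t x y'"
  "t (c *\<^sub>C x) y = c *\<^sub>C t x y"
  "t x (c *\<^sub>C y) = c *\<^sub>C t x y"
  "cinner (t x y) (t x' y') = cinner x x' * cinner y y'"
  using t unfolding hilbert_tensor_def by blast+

lemma tensor_0_right: "t x 0 = 0"
  using tensor_simps(4)[of x 0 0] by (simp add: complex_vector.scale_zero_left)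

lemma norm_tensor: "norm (t x y) = norm x * norm y"
proof -
  have "complex_of_real ((norm (t x y))\<^sup>2) = complex_of_real ((norm x * norm y)\<^sup>2)"
    by (simp only: cinner_self[symmetric] tensor_simps) (simp add: cinner_self power_mult_distrib)
  then have "(norm (t x y))\<^sup>2 = (norm x * norm y)\<^sup>2" by (simp only: of_real_eq_iff)
  then show ?thesis by (simp add: power2_eq_iff_nonneg)
qed

lemma tensor_sum_scaleC_left:
  "tensor_sum t (map (map_prod ((*\<^sub>C) c) id) L) = c *\<^sub>C tensor_sum t L"
  by (induction L) (auto simp: tensor_simps scaleC_add_right complex_vector.scale_zero_right)

text \<open>Scalars can be absorbed into the first factors, so plain sums of elementary tensors
  already form the whole span.\<close>

lemma closure_tensor_sum: "closure (range (tensor_sum t)) = UNIV"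
proof -
  have "complex_vector.subspace (range (tensor_sum t))"
  proof (rule complex_vector.subspaceI)
    show "0 \<in> range (tensor_sum t)" by (metis rangeI tensor_sum_simps(1))
    show "v + w \<in> range (tensor_sum t)" if "v \<in> range (tensor_sum t)" "w \<in> range (tensor_sum t)" for v w
      using that by (auto simp flip: tensor_sum_simps(3))
    show "c *\<^sub>C v \<in> range (tensor_sum t)" if "v \<in> range (tensor_sum t)" for c v
      using that by (auto simp flip: tensor_sum_scaleC_left)
  qed
  moreover have "t x y \<in> range (tensor_sum t)" for x y
    using rangeI[of "tensor_sum t" "[(x, y)]"] by simp
  ultimately have "cspan {t x y | x y. True} \<subseteq> range (tensor_sum t)"
    by (intro complex_vector.span_minimal) auto
  then show ?thesis
    using t closure_mono unfolding hilbert_tensor_def by blast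
qed

text \<open>Orthogonalising the second factors turns the norm of a finite sum of elementary tensors into a sum of
  squares, on which \<open>A \<otimes> I\<close> acts termwise.\<close>

lemma tensor_sum_orthogonal:
  fixes L :: "('a \<times> 'b) list"
  shows "\<exists>(N::nat) x f. (\<forall>i<N. \<forall>j<N. i \<noteq> j \<longrightarrow> cinner (f i) (f j) = 0) \<and>
    (\<forall>A. tensor_sum t (map (map_prod ((*\<^sub>V) A) id) L) = (\<Sum>j<N. t (A *\<^sub>V x j) (f j)))"
proof (induction L)
  case Nil
  show ?case by (rule exI[of _ 0]) simp
next
  case (Cons p L)
  obtain v y where p: "p = (v, y)" by (cases p)
  from Cons.IH obtain N :: nat and x f
    where orth: "\<And>i j. i < N \<Longrightarrow> j < N \<Longrightarrow> i \<noteq> j \<Longrightarrow> cinner (f i) (f j) = 0"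
      and sum: "\<And>A. tensor_sum t (map (map_prod ((*\<^sub>V) A) id) L) = (\<Sum>j<N. t (A *\<^sub>V x j) (f j))"
    by blast
  \<comment> \<open>The Gram-Schmidt coefficients of the new second factor \<open>y\<close>; when
    \<open>f j = 0\<close>, division by zero makes the coefficient 0, as it should be.\<close>
  define c where "c j = cinner y (f j) / cinner (f j) (f j)" for j
  define y' where "y' = y - (\<Sum>j<N. c j *\<^sub>C f j)"
  have y'_orth: "cinner y' (f i) = 0" if "i < N" for i
  proof -
    have "cinner (\<Sum>j<N. c j *\<^sub>C f j) (f i) = (\<Sum>j<N. if j = i then c i * cinner (f i) (f i) else 0)"
      unfolding cinner.sum_left cinner_scaleC_left using orth that by (intro sum.cong) auto
    also have "\<dots> = cinner y (f i)"
      using that by (cases "f i = 0") (auto simp: c_def cinner_self cinner.zero_right)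
    finally show ?thesis by (simp add: y'_def cinner.diff_left)
  qed
  \<comment> \<open>Expanding \<open>y\<close> as \<open>y'\<close> plus multiples of the
    \<open>f j\<close> moves these multiples of \<open>v\<close> into the old first factors. The
    coefficients do not depend on \<open>A\<close>, so one decomposition serves every
    operator.\<close>
  define x' where "x' j = (if j < N then x j + c j *\<^sub>C v else v)" for j
  define f' where "f' j = (if j < N then f j else y')" for j
  have "cinner (f' i) (f' j) = 0" if "i < Suc N" "j < Suc N" "i \<noteq> j" for i j
    using that orth y'_orth y'_orth[THEN cinner_eq_0_commute[THEN iffD1]]
    by (auto simp: f'_def less_Suc_eq)
  moreover have "tensor_sum t (map (map_prod ((*\<^sub>V) A) id) (p # L))
      = (\<Sum>j<Suc N. t (A *\<^sub>V x' j) (f' j))" for A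
  proof -
    have "t w (\<Sum>j\<in>J. c j *\<^sub>C f j) = (\<Sum>j\<in>J. c j *\<^sub>C t w (f j))" if "finite J" for w J
      using that by (induction J) (simp_all add: tensor_0_right tensor_simps)
    then have "t (A *\<^sub>V v) y = (\<Sum>j<N. c j *\<^sub>C t (A *\<^sub>V v) (f j)) + t (A *\<^sub>V v) y'"
      using tensor_simps(2)[of "A *\<^sub>V v" "\<Sum>j<N. c j *\<^sub>C f j" y'] by (simp add: y'_def)
    then show ?thesis
      by (simp add: p sum x'_def f'_def cblinfun.add_right cblinfun_scaleC_right tensor_simps sum.distrib)
  qed
  ultimately show ?case by blast
qed

lemma tensor_sum_op_bound:
  "norm (tensor_sum t (map (map_prod ((*\<^sub>V) A) id) L)) \<le> norm A * norm (tensor_sum t L)"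
proof -
  obtain N :: nat and x f where orth: "\<And>i j. i < N \<Longrightarrow> j < N \<Longrightarrow> i \<noteq> j \<Longrightarrow> cinner (f i) (f j) = 0"
    and sum: "\<And>A. tensor_sum t (map (map_prod ((*\<^sub>V) A) id) L) = (\<Sum>j<N. t (A *\<^sub>V x j) (f j))"
    using tensor_sum_orthogonal[of L] by blast
  have sq: "(norm (\<Sum>j<N. t (A *\<^sub>V x j) (f j)))\<^sup>2 = (\<Sum>j<N. (norm (A *\<^sub>V x j) * norm (f j))\<^sup>2)" for A
    by (subst norm_sum_cinner_orthogonal) (auto simp: tensor_simps orth norm_tensor)
  \<comment> \<open>The decomposition of \<open>L\<close> itself is its instance at the identity
    operator.\<close>
  have "map_prod ((*\<^sub>V) id_cblinfun) id = (id :: 'a \<times> 'b \<Rightarrow> _)" by (auto simp: fun_eq_iff)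
  then have id: "tensor_sum t L = (\<Sum>j<N. t (id_cblinfun *\<^sub>V x j) (f j))"
    using sum[of id_cblinfun] by simp
  have "(norm (\<Sum>j<N. t (A *\<^sub>V x j) (f j)))\<^sup>2 \<le> (\<Sum>j<N. (norm A * norm (x j) * norm (f j))\<^sup>2)"
    unfolding sq by (intro sum_mono power_mono mult_right_mono norm_cblinfun) auto
  also have "\<dots> = (norm A * norm (\<Sum>j<N. t (id_cblinfun *\<^sub>V x j) (f j)))\<^sup>2"
    unfolding power_mult_distrib[of "norm A"] sq by (simp add: power_mult_distrib sum_distrib_left mult.assoc)
  finally show ?thesis unfolding sum id by (rule power2_le_imp_le) simp
qed

text \<open>The graph consists of the pairs obtained from one list before and after \<open>A\<close>
  acts on its first factors; \<open>tensor_sum_op_bound\<close> is the bound needed to extend it by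
  density.\<close>

lemma op_tensor_left_exists:
  "\<exists>C. \<forall>x y. C *\<^sub>V t x y = t (A *\<^sub>V x) y"
proof -
  define G where "G = range (\<lambda>L. (tensor_sum t L, tensor_sum t (map (map_prod ((*\<^sub>V) A) id) L)))"
  obtain C where C: "\<And>a b. (a, b) \<in> G \<Longrightarrow> C *\<^sub>V a = b"
  proof (rule cblinfun_extension_by_density[of G "norm A"])
    fix a b a' b' assume "(a, b) \<in> G" "(a', b') \<in> G"
    then obtain L L' where "a = tensor_sum t L" "b = tensor_sum t (map (map_prod ((*\<^sub>V) A) id) L)"
      "a' = tensor_sum t L'" "b' = tensor_sum t (map (map_prod ((*\<^sub>V) A) id) L')"
      unfolding G_def by blast
    then show "(a + a', b + b') \<in> G" unfolding G_def by (intro image_eqI[of _ _ "L @ L'"]) auto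
  next
    fix a b c assume "(a, b) \<in> G"
    then obtain L where L: "a = tensor_sum t L" "b = tensor_sum t (map (map_prod ((*\<^sub>V) A) id) L)"
      unfolding G_def by blast
    have "map (map_prod ((*\<^sub>V) A) id) (map (map_prod ((*\<^sub>C) c) id) L)
        = map (map_prod ((*\<^sub>C) c) id) (map (map_prod ((*\<^sub>V) A) id) L)"
      by (auto simp: cblinfun_scaleC_right)
    with L show "(c *\<^sub>C a, c *\<^sub>C b) \<in> G" unfolding G_def
      by (intro image_eqI[of _ _ "map (map_prod ((*\<^sub>C) c) id) L"])
        (simp_all only: tensor_sum_scaleC_left, auto)
  next
    show "norm b \<le> norm A * norm a" if "(a, b) \<in> G" for a b
      using that tensor_sum_op_bound by (auto simp: G_def)
    show "closure (fst ` G) = UNIV"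
      using closure_tensor_sum by (simp add: G_def image_image)
  qed blast
  have "C *\<^sub>V t x y = t (A *\<^sub>V x) y" for x y
    by (rule C) (auto simp: G_def intro!: image_eqI[of _ _ "[(x, y)]"])
  then show ?thesis by blast
qed

lemma cblinfun_eq_on_tensors:
  fixes C D :: "('p, 'p) cblinfun"
  assumes "\<And>x y. C *\<^sub>V t x y = D *\<^sub>V t x y"
  shows "C = D"
proof (rule cblinfun_eqI)
  fix z
  have "C *\<^sub>V tensor_sum t L = D *\<^sub>V tensor_sum t L" for L
    by (induction L) (auto simp: cblinfun.zero_right cblinfun.add_right assms)
  then have "range (tensor_sum t) \<subseteq> {z. C *\<^sub>V z = D *\<^sub>V z}" by auto
  moreover have "closed {z. C *\<^sub>V z = D *\<^sub>V z}"
    by (intro closed_Collect_eq cblinfun.continuous_on continuous_intros)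
  ultimately have "closure (range (tensor_sum t)) \<subseteq> {z. C *\<^sub>V z = D *\<^sub>V z}"
    by (rule closure_minimal)
  then show "C *\<^sub>V z = D *\<^sub>V z" by (auto simp: closure_tensor_sum)
qed

end

text \<open>This symmetry carries results on operators in the first factor over to the
  second.\<close>

lemma hilbert_tensor_flip:
  assumes "hilbert_tensor t"
  shows "hilbert_tensor (\<lambda>y x. t x y)"
proof -
  have "{t x y | y x. True} = {t x y | x y. True}" by blast
  with assms show ?thesis unfolding hilbert_tensor_def
    by (simp add: mult.commute)
qed

text \<open>The tensor product of \<open>A\<close> and \<open>B\<close> is the product of one
  operator acting on the first factor and one acting on the second. Density of the tensor sums makes
  it the unique candidate in \<open>op_tensor\<close>.\<close>

lemma op_tensor_apply:
  assumes t: "hilbert_tensor t"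
  shows "op_tensor t A B *\<^sub>V t x y = t (A *\<^sub>V x) (B *\<^sub>V y)"
proof -
  obtain C where C: "\<And>x y. C *\<^sub>V t x y = t (A *\<^sub>V x) y"
    using op_tensor_left_exists[OF t, of A] by blast
  obtain D where D: "\<And>x y. D *\<^sub>V t x y = t x (B *\<^sub>V y)"
    using op_tensor_left_exists[OF hilbert_tensor_flip[OF t], of B] by blast
  have CD: "\<forall>x y. (C o\<^sub>C\<^sub>L D) *\<^sub>V t x y = t (A *\<^sub>V x) (B *\<^sub>V y)" by (simp add: C D)
  have "op_tensor t A B = C o\<^sub>C\<^sub>L D"
    unfolding op_tensor_def
  proof (rule the_equality, rule CD)
    show "E = C o\<^sub>C\<^sub>L D" if "\<forall>x y. E *\<^sub>V t x y = t (A *\<^sub>V x) (B *\<^sub>V y)" for E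
      by (rule cblinfun_eq_on_tensors[OF t]) (simp only: that CD)
  qed
  then show ?thesis using CD by simp
qed

section \<open>Orthonormal sequences\<close>

fun gram_schmidt :: "(nat \<Rightarrow> 'a::complex_inner) \<Rightarrow> nat \<Rightarrow> 'a" where
  "gram_schmidt g n =
     sgn (g n - (\<Sum>k<n. cinner (g n) (gram_schmidt g k) *\<^sub>C gram_schmidt g k))"

declare gram_schmidt.simps [simp del]

text \<open>Since \<open>sgn 0 = 0\<close>, linearly dependent vectors contribute zeros.\<close>

lemma norm_gram_schmidt: "gram_schmidt g n \<noteq> 0 \<Longrightarrow> norm (gram_schmidt g n) = 1"
  by (subst (asm) gram_schmidt.simps, subst gram_schmidt.simps) (simp only: norm_sgn sgn_zero_iff if_False)

lemma sgn_scaleC: "sgn x = complex_of_real (inverse (norm x)) *\<^sub>C x" for x :: "'a::complex_inner"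
  by (simp only: sgn_div_norm scaleC_of_real)

lemma gram_schmidt_orthogonal:
  assumes "i \<noteq> j"
  shows "cinner (gram_schmidt g i) (gram_schmidt g j) = 0"
proof -
  let ?f = "gram_schmidt g"
  have "\<forall>i<n. cinner (?f n) (?f i) = 0" for n
  proof (induction n rule: less_induct)
    case (less n)
    have "cinner (\<Sum>k<n. cinner (g n) (?f k) *\<^sub>C ?f k) (?f i) = cinner (g n) (?f i)" if "i < n" for i
    proof -
      have "cinner (?f k) (?f i) = 0" if "k < n" "k \<noteq> i" for k
        using less.IH \<open>i < n\<close> that cinner_eq_0_commute[of "?f k" "?f i"]
        by (cases k i rule: linorder_cases) auto
      then have "cinner (\<Sum>k<n. cinner (g n) (?f k) *\<^sub>C ?f k) (?f i)
          = (\<Sum>k<n. if k = i then cinner (g n) (?f i) * cinner (?f i) (?f i) else 0)"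
        unfolding cinner.sum_left cinner_scaleC_left by (intro sum.cong) auto
      also have "\<dots> = cinner (g n) (?f i)"
        using that norm_gram_schmidt[of g i]
        by (cases "?f i = 0") (auto simp: cinner_self cinner.zero_right)
      finally show ?thesis .
    qed
    then show ?case
      by (subst gram_schmidt.simps) (simp add: sgn_scaleC cinner_scaleC_left cinner.diff_left)
  qed
  with assms show ?thesis
    by (cases i j rule: linorder_cases) (auto simp: cinner_eq_0_commute[of "?f i" "?f j"])
qed

lemma cspan_gram_schmidt: "gram_schmidt g n \<in> cspan (g ` {..n})"
proof (induction n rule: less_induct)
  case (less n)
  have "gram_schmidt g k \<in> cspan (g ` {..n})" if "k < n" for k
    using less.IH[OF that] complex_vector.span_mono[OF image_mono, of "{..k}" "{..n}" g] that
    by auto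
  then show ?case
    by (subst gram_schmidt.simps)
      (auto simp: sgn_scaleC intro!: complex_vector.span_scale complex_vector.span_diff
        complex_vector.span_sum intro: complex_vector.span_base)
qed

lemma in_cspan_gram_schmidt: "g n \<in> cspan (range (gram_schmidt g))"
proof -
  define q where "q = g n - (\<Sum>k<n. cinner (g n) (gram_schmidt g k) *\<^sub>C gram_schmidt g k)"
  have "gram_schmidt g n = sgn q" unfolding q_def by (rule gram_schmidt.simps)
  then have "q = complex_of_real (norm q) *\<^sub>C gram_schmidt g n"
    by (cases "q = 0") (auto simp: sgn_div_norm scaleC_of_real complex_vector.scale_zero_right)
  moreover have "g n = q + (\<Sum>k<n. cinner (g n) (gram_schmidt g k) *\<^sub>C gram_schmidt g k)"
    by (simp add: q_def)
  ultimately show ?thesis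
    by (metis (mono_tags, lifting) complex_vector.span_add complex_vector.span_base
        complex_vector.span_scale complex_vector.span_sum rangeI)
qed

text \<open>No finite set spans, so each vector of a sequence can be chosen outside the span of its
  predecessors. Gram-Schmidt then never produces a zero, since a zero would put \<open>g n\<close>
  into that span.\<close>

lemma orthonormal_sequence_exists:
  assumes "\<not> (\<exists>S :: 'a::complex_inner set. finite S \<and> cspan S = UNIV)"
  shows "\<exists>e :: nat \<Rightarrow> 'a. \<forall>i j. cinner (e i) (e j) = (if i = j then 1 else 0)"
proof -
  have "\<exists>g :: nat \<Rightarrow> 'a. \<forall>n. g n \<notin> cspan (g ` {..<n})"
  proof (rule dependent_wf_choice[of less_than])
    show "(r \<notin> cspan (f ` {..<x})) = (r \<notin> cspan (g ` {..<x}))"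
      if "\<And>z. (z, x) \<in> less_than \<Longrightarrow> f z = g z" for f g :: "nat \<Rightarrow> 'a" and x r
    proof -
      have "f ` {..<x} = g ` {..<x}" using that by (intro image_cong) auto
      then show ?thesis by simp
    qed
    show "\<exists>r. r \<notin> cspan (f ` {..<x})" for f :: "nat \<Rightarrow> 'a" and x
      using assms by (metis UNIV_eq_I finite_imageI finite_lessThan)
  qed simp
  then obtain g :: "nat \<Rightarrow> 'a" where g: "\<And>n. g n \<notin> cspan (g ` {..<n})" by blast
  have "gram_schmidt g n \<noteq> 0" for n
  proof
    assume "gram_schmidt g n = 0"
    then have "g n = (\<Sum>k<n. cinner (g n) (gram_schmidt g k) *\<^sub>C gram_schmidt g k)"
      by (subst (asm) gram_schmidt.simps) (simp add: sgn_zero_iff)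
    moreover have "gram_schmidt g k \<in> cspan (g ` {..<n})" if "k < n" for k
    proof -
      have "{..k} \<subseteq> {..<n}" using that by auto
      then show ?thesis
        using cspan_gram_schmidt[of g k] complex_vector.span_mono[OF image_mono] by blast
    qed
    ultimately show False
      using g[of n] complex_vector.span_sum complex_vector.span_scale
      by (metis (no_types, lifting) lessThan_iff)
  qed
  then have "cinner (gram_schmidt g i) (gram_schmidt g j) = (if i = j then 1 else 0)" for i j
    using gram_schmidt_orthogonal[of i j g] norm_gram_schmidt[of g i] by (auto simp: cinner_self)
  then show ?thesis by blast
qed

text \<open>The partial sum \<open>p\<close> of the Fourier expansion satisfies
  \<open>cinner x p = (norm p)\<^sup>2\<close>, and the Cauchy-Schwarz inequality bounds this by
  \<open>norm x * norm p\<close>.\<close>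

lemma bessel_inequality:
  fixes e :: "nat \<Rightarrow> 'a::complex_inner"
  assumes e: "\<And>i j. cinner (e i) (e j) = (if i = j then 1 else 0)"
  shows "(\<Sum>i<n. (cmod (cinner x (e i)))\<^sup>2) \<le> (norm x)\<^sup>2"
proof -
  define p where "p = (\<Sum>i<n. cinner x (e i) *\<^sub>C e i)"
  have norm_e: "norm (e i) = 1" for i
  proof -
    have "complex_of_real ((norm (e i))\<^sup>2) = complex_of_real 1"
      using e[of i i] unfolding cinner_self by simp
    then have "(norm (e i))\<^sup>2 = 1" by (simp only: of_real_eq_iff)
    then show ?thesis using norm_ge_zero[of "e i"] by (simp add: power2_eq_1_iff)
  qed
  have norm_p: "(norm p)\<^sup>2 = (\<Sum>i<n. (cmod (cinner x (e i)))\<^sup>2)"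
    unfolding p_def
    by (subst norm_sum_cinner_orthogonal)
      (auto simp: e cinner_scaleC_left cinner_scaleC_right norm_scaleC norm_e)
  have "cinner x p = (\<Sum>i<n. (cmod (cinner x (e i)))\<^sup>2)"
    by (simp add: p_def cinner.sum_right cinner_scaleC_right mult.commute flip: complex_norm_square)
  then have "cinner x p = (norm p)\<^sup>2" by (simp only: norm_p)
  then have "(norm p)\<^sup>2 \<le> norm x * norm p"
    using norm_cinner_le[of x p] by (simp add: norm_power)
  then have "norm p \<le> norm x"
    by (cases "norm p = 0") (simp_all add: power2_eq_square)
  then show ?thesis unfolding norm_p[symmetric] by (rule power_mono) simp
qed

text \<open>\<open>C\<close> sends \<open>e i\<close> to \<open>f i\<close> and vanishes on the
  orthogonal complement of the \<open>e i\<close>. Zeros among the \<open>f i\<close> are allowed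
  because Gram-Schmidt can produce them. The composition of \<open>C\<close> with its adjoint is the
  projection onto the closed span of the \<open>f i\<close>.\<close>

lemma partial_isometry_exists:
  fixes e :: "nat \<Rightarrow> 'a::chilbert_space" and f :: "nat \<Rightarrow> 'b::chilbert_space"
  assumes e: "\<And>i j. cinner (e i) (e j) = (if i = j then 1 else 0)"
    and f: "\<And>i j. i \<noteq> j \<Longrightarrow> cinner (f i) (f j) = 0" "\<And>i. f i \<noteq> 0 \<Longrightarrow> norm (f i) = 1"
  shows "\<exists>C :: ('a, 'b) cblinfun. (\<forall>x. norm (C *\<^sub>V x) \<le> norm x) \<and> (\<forall>x. C *\<^sub>V x \<in> closure (cspan (range f))) \<and>
    (\<forall>n. C *\<^sub>V adj C *\<^sub>V f n = f n)"
proof -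
  have f_le: "norm (f i) \<le> 1" for i using f(2)[of i] by (cases "f i = 0") auto
  \<comment> \<open>Applied to blocks of indices, this estimate and Bessel's inequality make the
    series Cauchy; applied to initial segments, they make \<open>C\<close> a contraction.\<close>
  have part: "(norm (\<Sum>i\<in>I. cinner x (e i) *\<^sub>C f i))\<^sup>2 \<le> (\<Sum>i\<in>I. (cmod (cinner x (e i)))\<^sup>2)"
    if "finite I" for x I
  proof -
    have "(norm (\<Sum>i\<in>I. cinner x (e i) *\<^sub>C f i))\<^sup>2 = (\<Sum>i\<in>I. (norm (cinner x (e i) *\<^sub>C f i))\<^sup>2)"
      using that by (rule norm_sum_cinner_orthogonal) (simp add: f cinner_scaleC_left cinner_scaleC_right)
    also have "\<dots> \<le> (\<Sum>i\<in>I. (cmod (cinner x (e i)))\<^sup>2)"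
      by (intro sum_mono power_mono) (auto simp: norm_scaleC f_le intro: mult_left_le)
    finally show ?thesis .
  qed
  have summ: "summable (\<lambda>i. cinner x (e i) *\<^sub>C f i)" for x
    unfolding summable_Cauchy
  proof (intro allI impI)
    fix d :: real assume "d > 0"
    have "summable (\<lambda>i. (cmod (cinner x (e i)))\<^sup>2)"
      using bessel_inequality[OF e] by (intro summableI_nonneg_bounded) auto
    then obtain N where N: "\<And>m n. m \<ge> N \<Longrightarrow> norm (\<Sum>i=m..<n. (cmod (cinner x (e i)))\<^sup>2) < d\<^sup>2"
      unfolding summable_Cauchy using \<open>d > 0\<close> by (meson zero_less_power)
    have "norm (\<Sum>i=m..<n. cinner x (e i) *\<^sub>C f i) < d" if "m \<ge> N" for m n
    proof (rule power_less_imp_less_base)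
      show "(norm (\<Sum>i=m..<n. cinner x (e i) *\<^sub>C f i))\<^sup>2 < d\<^sup>2"
        using part[of "{m..<n}" x] N[OF that, of n] by simp
    qed (use \<open>d > 0\<close> in simp)
    then show "\<exists>N. \<forall>m\<ge>N. \<forall>n. norm (\<Sum>i=m..<n. cinner x (e i) *\<^sub>C f i) < d" by blast
  qed
  define c where "c x = (\<Sum>i. cinner x (e i) *\<^sub>C f i)" for x
  have c_lim: "(\<lambda>n. \<Sum>i<n. cinner x (e i) *\<^sub>C f i) \<longlonglongrightarrow> c x" for x
    unfolding c_def using summable_LIMSEQ[OF summ] .
  have c_bound: "norm (c x) \<le> norm x" for x
  proof (rule LIMSEQ_le_const2[OF tendsto_norm[OF c_lim]], intro exI allI impI)
    show "norm (\<Sum>i<n. cinner x (e i) *\<^sub>C f i) \<le> norm x" for n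
      by (rule power2_le_imp_le[OF order_trans[OF part bessel_inequality[OF e]]]) simp_all
  qed
  have "\<exists>C. \<forall>x. C *\<^sub>V x = c x"
  proof (rule cblinfun_exists[of c 1])
    show "c (x + y) = c x + c y" for x y
      unfolding c_def suminf_add[OF summ summ]
      by (simp only: cinner_add_left scaleC_add_left)
    show "c (a *\<^sub>C x) = a *\<^sub>C c x" for a x
      unfolding c_def
      unfolding bounded_linear.suminf[OF bounded_linear_scaleC summ]
      by (simp only: cinner_scaleC_left scaleC_scaleC)
  qed (use c_bound in auto)
  then obtain C where C: "\<And>x. C *\<^sub>V x = c x" by blast
  have c_e: "c (e n) = f n" for n
  proof -
    have "c (e n) = (\<Sum>i\<in>{n}. cinner (e n) (e i) *\<^sub>C f i)"
      unfolding c_def by (rule suminf_finite) (auto simp: e complex_vector.scale_zero_left)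
    then show ?thesis by (simp add: e)
  qed
  have adj_f: "adj C *\<^sub>V f n = (if f n = 0 then 0 else e n)" for n
  proof (cases "f n = 0")
    case True
    then show ?thesis by (simp add: cblinfun.zero_right)
  next
    case False
    have "cinner (e n) x = cinner (adj C *\<^sub>V f n) x" for x
    proof -
      have "cinner (c x) (f n) = (\<Sum>i. cinner (cinner x (e i) *\<^sub>C f i) (f n))"
        unfolding c_def by (rule bounded_linear.suminf[OF cinner.bounded_linear_left summ])
      also have "\<dots> = (\<Sum>i\<in>{n}. cinner (cinner x (e i) *\<^sub>C f i) (f n))"
        by (rule suminf_finite) (auto simp: f cinner_scaleC_left)
      also have "\<dots> = cinner x (e n)"
        using f(2)[OF False] by (simp add: cinner_scaleC_left cinner_self)
      finally have "cinner x (adj C *\<^sub>V f n) = cinner x (e n)"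
        by (simp add: C flip: cinner_adj)
      from arg_cong[OF this, of cnj] show ?thesis by (simp flip: cinner_commute)
    qed
    with False show ?thesis by (metis cinner_ext)
  qed
  have "C *\<^sub>V adj C *\<^sub>V f n = f n" for n
    by (simp add: adj_f C c_e cblinfun.zero_right flip: C[of 0])
  moreover have "C *\<^sub>V x \<in> closure (cspan (range f))" for x
  proof -
    have "(\<Sum>i<n. cinner x (e i) *\<^sub>C f i) \<in> cspan (range f)" for n
      by (intro complex_vector.span_sum complex_vector.span_scale complex_vector.span_base rangeI)
    then show ?thesis unfolding C closure_sequential
      by (intro exI[of _ "\<lambda>n. \<Sum>i<n. cinner x (e i) *\<^sub>C f i"] conjI allI c_lim)
  qed
  moreover have "norm (C *\<^sub>V x) \<le> norm x" for x using c_bound by (simp add: C)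
  ultimately show ?thesis by blast
qed


section \<open>Compressing the dilation to a separable space\<close>

lemma op_word_simps [simp]:
  "op_word T [] = id_cblinfun"
  "op_word T (i # \<alpha>) = T $ i o\<^sub>C\<^sub>L op_word T \<alpha>"
  by (simp_all add: op_word_def)

lemma op_word_scaleR: "op_word (r *\<^sub>R T) \<alpha> *\<^sub>V x = r ^ length \<alpha> *\<^sub>R (op_word T \<alpha> *\<^sub>V x)"
  by (induction \<alpha>) (simp_all add: cblinfun.scaleR_left cblinfun.scaleR_right mult.commute)

text \<open>For \<open>Z = \<Sum> X\<^sub>i X\<^sub>i\<^sup>*\<close> one has \<open>\<parallel>Z k\<parallel>\<^sup>2 \<le> \<Sum> \<parallel>X\<^sub>i\<^sup>* k\<parallel>\<^sup>2 = \<langle>Z k, k\<rangle> \<le> \<parallel>Z k\<parallel> \<parallel>k\<parallel>\<close>.\<close>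

lemma row_cballI:
  fixes X :: "('n::finite, 'a::chilbert_space) op_tuple"
  assumes "\<And>k. (norm (\<Sum>i\<in>UNIV. X $ i *\<^sub>V k i))\<^sup>2 \<le> (\<Sum>i\<in>UNIV. (norm (k i))\<^sup>2)"
  shows "X \<in> row_cball"
  unfolding row_cball_def mem_Collect_eq
proof (rule norm_cblinfun_bound)
  fix k :: 'a
  define z where "z = (\<Sum>i\<in>UNIV. X $ i o\<^sub>C\<^sub>L adj (X $ i)) *\<^sub>V k"
  have z: "z = (\<Sum>i\<in>UNIV. X $ i *\<^sub>V adj (X $ i) *\<^sub>V k)"
    by (simp add: z_def cblinfun.sum_left)
  have "complex_of_real (\<Sum>i\<in>UNIV. (norm (adj (X $ i) *\<^sub>V k))\<^sup>2) = cinner z k"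
    by (simp add: z cinner.sum_left cinner_adj cinner_self)
  from arg_cong[OF this, of cmod] have "(\<Sum>i\<in>UNIV. (norm (adj (X $ i) *\<^sub>V k))\<^sup>2) = cmod (cinner z k)"
    unfolding norm_of_real by (simp add: sum_nonneg)
  then have "(norm z)\<^sup>2 \<le> norm z * norm k"
    using assms[of "\<lambda>i. adj (X $ i) *\<^sub>V k"] norm_cinner_le[of z k] by (simp add: z)
  then have "norm z \<le> norm k" by (cases "norm z = 0") (simp_all add: power2_eq_square)
  then show "norm ((\<Sum>i\<in>UNIV. X $ i o\<^sub>C\<^sub>L adj (X $ i)) *\<^sub>V k) \<le> 1 * norm k"
    by (simp add: z_def)
qed simp

lemma adj_scaleR: "adj (r *\<^sub>R A) = r *\<^sub>R adj A"
proof (rule cblinfun_eqI, rule cinner_ext)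
  show "cinner (adj (r *\<^sub>R A) *\<^sub>V x) y = cinner ((r *\<^sub>R adj A) *\<^sub>V x) y" for x y
    by (simp add: cinner_adj_left cblinfun.scaleR_left cinner_scaleR_left cinner_scaleR_right)
qed

lemma cblinfun_compose_scaleR: "(r *\<^sub>R A) o\<^sub>C\<^sub>L (s *\<^sub>R B) = (r * s) *\<^sub>R (A o\<^sub>C\<^sub>L B)"
  by (rule cblinfun_eqI) (simp add: cblinfun.scaleR_left cblinfun.scaleR_right)

lemma row_ball_scaleR:
  fixes X :: "('n::finite, 'a::chilbert_space) op_tuple"
  assumes "X \<in> row_cball" "0 \<le> r" "r < 1"
  shows "r *\<^sub>R X \<in> row_ball"
proof -
  let ?Z = "\<Sum>i\<in>UNIV. X $ i o\<^sub>C\<^sub>L adj (X $ i)"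
  have "norm (\<Sum>i\<in>UNIV. (r *\<^sub>R X) $ i o\<^sub>C\<^sub>L adj ((r *\<^sub>R X) $ i)) = r\<^sup>2 * norm ?Z"
    by (simp add: adj_scaleR cblinfun_compose_scaleR power2_eq_square flip: scaleR_right.sum)
  also have "\<dots> \<le> r\<^sup>2 * 1"
    using assms(1) by (intro mult_left_mono) (auto simp: row_cball_def)
  also have "\<dots> < 1" using assms(2,3) by (simp add: power_less_one_iff)
  finally show ?thesis by (simp add: row_ball_def)
qed

lemma row_cball_subset: "row_ball \<subseteq> row_cball"
  by (auto simp: row_ball_def row_cball_def)

lemma adj_contraction:
  assumes "\<And>x. norm (C *\<^sub>V x) \<le> norm x"
  shows "norm (adj C *\<^sub>V z) \<le> norm z"
proof -
  have "(norm (adj C *\<^sub>V z))\<^sup>2 = cmod (cinner z (C *\<^sub>V adj C *\<^sub>V z))"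
    by (simp add: cinner_self norm_power flip: cinner_adj_left)
  also have "\<dots> \<le> norm z * norm (C *\<^sub>V adj C *\<^sub>V z)" by (rule norm_cinner_le)
  also have "\<dots> \<le> norm z * norm (adj C *\<^sub>V z)" by (intro mult_left_mono assms) simp
  finally show ?thesis by (cases "norm (adj C *\<^sub>V z) = 0") (simp_all add: power2_eq_square)
qed

text \<open>\<open>C\<close> maps onto the closed span of all words in the \<open>V $ i\<close>
  applied to \<open>D\<close>. A vector is fixed by \<open>C *\<^sub>V adj C *\<^sub>V _\<close>
  when it lies in this subspace, so the last two properties say that the subspace contains
  \<open>D\<close> and is invariant under the \<open>V $ i\<close>.\<close>

lemma separable_compression:
  fixes V :: "('n::finite, 'g::chilbert_space) op_tuple" and D :: "'g set"
  assumes inf_dim: "\<not> (\<exists>S :: 'k::chilbert_space set. finite S \<and> cspan S = UNIV)"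
    and "countable D"
  shows "\<exists>C :: ('k, 'g) cblinfun. (\<forall>x. norm (C *\<^sub>V x) \<le> norm x) \<and>
    (\<forall>d\<in>D. C *\<^sub>V adj C *\<^sub>V d = d) \<and>
    (\<forall>i x. C *\<^sub>V adj C *\<^sub>V V $ i *\<^sub>V C *\<^sub>V x = V $ i *\<^sub>V C *\<^sub>V x)"
proof -
  \<comment> \<open>There are countably many words, so \<open>G\<close> is countable; the extra 0
    keeps it nonempty for the enumeration when \<open>D\<close> is empty.\<close>
  define G where "G = insert 0 ((\<lambda>(\<alpha>, d). op_word V \<alpha> *\<^sub>V d) ` (UNIV \<times> D))"
  have "countable G" unfolding G_def using assms(2) by (intro countable_insert countable_image countable_SIGMA) auto
  define g where "g = from_nat_into G"
  have g: "range g = G"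
    unfolding g_def using \<open>countable G\<close> by (intro range_from_nat_into) (auto simp: G_def)
  obtain e :: "nat \<Rightarrow> 'k" where e: "\<And>i j. cinner (e i) (e j) = (if i = j then 1 else 0)"
    using orthonormal_sequence_exists[OF inf_dim] by blast
  define f where "f = gram_schmidt g"
  obtain C :: "('k, 'g) cblinfun" where C: "\<And>x. norm (C *\<^sub>V x) \<le> norm x"
      "\<And>x. C *\<^sub>V x \<in> closure (cspan (range f))" "\<And>n. C *\<^sub>V adj C *\<^sub>V f n = f n"
    using partial_isometry_exists[OF e, of f] gram_schmidt_orthogonal norm_gram_schmidt
    unfolding f_def by blast
  have span_fg: "cspan (range f) = cspan (range g)"
  proof
    have "cspan (g ` {..n}) \<subseteq> cspan (range g)" for n
      by (rule complex_vector.span_mono) auto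
    then show "cspan (range f) \<subseteq> cspan (range g)"
      using cspan_gram_schmidt[of g] unfolding f_def
      by (intro complex_vector.span_minimal) (auto simp: complex_vector.subspace_span)
    show "cspan (range g) \<subseteq> cspan (range f)"
      using in_cspan_gram_schmidt[of g] unfolding f_def
      by (intro complex_vector.span_minimal) (auto simp: complex_vector.subspace_span)
  qed
  have fixed: "C *\<^sub>V adj C *\<^sub>V z = z" if "z \<in> closure (cspan (range f))" for z
  proof -
    have "complex_vector.subspace {z. C *\<^sub>V adj C *\<^sub>V z = z}"
      by (rule complex_vector.subspaceI)
        (auto simp: cblinfun.zero_right cblinfun.add_right cblinfun_scaleC_right)
    then have "cspan (range f) \<subseteq> {z. C *\<^sub>V adj C *\<^sub>V z = z}"
      using C(3) by (intro complex_vector.span_minimal) auto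
    moreover have "closed {z. C *\<^sub>V adj C *\<^sub>V z = z}"
      by (intro closed_Collect_eq cblinfun.continuous_on continuous_intros)
    ultimately show ?thesis using that closure_minimal by blast
  qed
  have inv: "V $ i *\<^sub>V z \<in> closure (cspan (range f))" if "z \<in> closure (cspan (range f))" for i z
  proof -
    \<comment> \<open>Applying \<open>V $ i\<close> prepends a letter to the word, so
      \<open>G\<close> is mapped into itself; linearity and continuity pass this on to the closed
      span.\<close>
    have "V $ i *\<^sub>V z \<in> G" if zG: "z \<in> G" for z
    proof (cases "z = 0")
      case False
      then obtain \<alpha> d where "z = op_word V \<alpha> *\<^sub>V d" "d \<in> D"
        using zG unfolding G_def by auto
      then show ?thesis
        unfolding G_def by (intro insertI2 image_eqI[of _ _ "(i # \<alpha>, d)"]) auto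
    qed (simp add: G_def cblinfun.zero_right)
    then have "range g \<subseteq> {z. V $ i *\<^sub>V z \<in> cspan (range g)}"
      by (auto simp: g intro: complex_vector.span_base)
    moreover have "complex_vector.subspace {z. V $ i *\<^sub>V z \<in> cspan (range g)}"
      by (rule complex_vector.subspaceI)
        (auto simp: cblinfun.zero_right cblinfun.add_right cblinfun_scaleC_right
          complex_vector.span_zero complex_vector.span_add complex_vector.span_scale)
    ultimately have "cspan (range g) \<subseteq> {z. V $ i *\<^sub>V z \<in> cspan (range g)}"
      by (rule complex_vector.span_minimal)
    then have "(*\<^sub>V) (V $ i) ` closure (cspan (range f)) \<subseteq> closure (cspan (range f))"
      unfolding span_fg
      by (intro image_closure_subset cblinfun.continuous_on continuous_intros)
        (auto intro: closure_subset[THEN subsetD])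
    with that show ?thesis by blast
  qed
  have "d \<in> closure (cspan (range f))" if "d \<in> D" for d
  proof -
    have "d \<in> G" unfolding G_def using that by (auto intro!: image_eqI[of _ _ "([], d)"])
    then show ?thesis
      unfolding span_fg g by (intro closure_subset[THEN subsetD] complex_vector.span_base)
  qed
  with C(1,2) fixed inv show ?thesis by blast
qed

lemma class_C_compression:
  fixes T :: "('n::finite, 'h::chilbert_space) op_tuple" and S :: "'h set"
  assumes inf_dim: "\<not> (\<exists>S :: 'k::chilbert_space set. finite S \<and> cspan S = UNIV)"
    and "class_C TYPE('g::chilbert_space) \<rho> T" and "countable S"
  shows "\<exists>(X :: ('n, 'k) op_tuple) (W :: ('h, 'k) cblinfun). X \<in> row_cball \<and>
    (\<forall>x\<in>S. \<forall>y\<in>S. cinner (W *\<^sub>V x) (W *\<^sub>V y) = cinner x y) \<and>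
    (\<forall>\<alpha>. \<alpha> \<noteq> [] \<longrightarrow> (\<forall>x\<in>S. \<forall>y\<in>S.
      cinner (op_word T \<alpha> *\<^sub>V x) y = \<rho> *\<^sub>R cinner (op_word X \<alpha> *\<^sub>V W *\<^sub>V x) (W *\<^sub>V y)))"
proof -
  from assms(2) obtain J :: "('h, 'g) cblinfun" and V :: "('n, 'g) op_tuple"
    where J: "isometry J" and V: "\<And>i. isometry (V $ i)"
      and orth: "\<And>i j x y. i \<noteq> j \<Longrightarrow> cinner (V $ i *\<^sub>V x) (V $ j *\<^sub>V y) = 0"
      and dil: "\<And>\<alpha> x. \<alpha> \<noteq> [] \<Longrightarrow> J *\<^sub>V op_word T \<alpha> *\<^sub>V x
             = \<rho> *\<^sub>R orth_proj (range (\<lambda>h. J *\<^sub>V h)) (op_word V \<alpha> *\<^sub>V J *\<^sub>V x)"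
    unfolding class_C_def by blast
  have norm_J: "norm (J *\<^sub>V x) = norm x" for x using J by (simp add: isometry_def)
  have inner_J: "inner (J *\<^sub>V x) (J *\<^sub>V y) = inner x y" for x y
    using norm_J[of "x + y"]
    by (simp add: norm_eq_sqrt_inner inner_simps cblinfun.add_right)
      (use norm_J[of x] norm_J[of y] in \<open>simp add: norm_eq_sqrt_inner inner_commute\<close>)
  have cinner_J: "cinner (J *\<^sub>V x) (J *\<^sub>V y) = cinner x y" for x y
  proof (rule complex_eqI)
    show "Re (cinner (J *\<^sub>V x) (J *\<^sub>V y)) = Re (cinner x y)" by (simp add: Re_cinner inner_J)
    have "Re (cinner (J *\<^sub>V x) (J *\<^sub>V \<i> *\<^sub>C y)) = Re (cinner x (\<i> *\<^sub>C y))" by (simp add: Re_cinner inner_J)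
    then show "Im (cinner (J *\<^sub>V x) (J *\<^sub>V y)) = Im (cinner x y)"
      by (simp add: cblinfun_scaleC_right cinner_scaleC_right)
  qed
  let ?M = "range (\<lambda>h. J *\<^sub>V h)"
  have "closed ?M"
  proof -
    have "complete ?M"
      by (rule complete_isometric_image[of 1]) (auto simp: norm_J complete_UNIV cblinfun.bounded_linear_right)
    then show ?thesis by (rule complete_imp_closed)
  qed
  moreover have "complex_vector.subspace ?M"
  proof (rule complex_vector.subspaceI)
    show "0 \<in> ?M" by (rule image_eqI[of _ _ 0]) (simp_all add: cblinfun.zero_right)
    show "x + y \<in> ?M" if "x \<in> ?M" "y \<in> ?M" for x y
      using that by (auto simp flip: cblinfun.add_right)
    show "c *\<^sub>C x \<in> ?M" if "x \<in> ?M" for c x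
      using that by (auto simp flip: cblinfun_scaleC_right)
  qed
  ultimately have proj: "cinner (orth_proj ?M z) (J *\<^sub>V y) = cinner z (J *\<^sub>V y)" for z y
    by (rule orth_proj(2)) simp
  have T_word: "cinner (op_word T \<alpha> *\<^sub>V x) y = \<rho> *\<^sub>R cinner (op_word V \<alpha> *\<^sub>V J *\<^sub>V x) (J *\<^sub>V y)"
    if "\<alpha> \<noteq> []" for \<alpha> x y
    using cinner_J[of "op_word T \<alpha> *\<^sub>V x" y] dil[OF that]
    by (simp add: cinner_scaleR_left proj)

  have "countable ((*\<^sub>V) J ` S)" using assms(3) by simp
  then obtain C :: "('k, 'g) cblinfun" where C: "\<And>x. norm (C *\<^sub>V x) \<le> norm x"
    "\<And>x. x \<in> S \<Longrightarrow> C *\<^sub>V adj C *\<^sub>V J *\<^sub>V x = J *\<^sub>V x"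
    "\<And>i x. C *\<^sub>V adj C *\<^sub>V V $ i *\<^sub>V C *\<^sub>V x = V $ i *\<^sub>V C *\<^sub>V x"
    using separable_compression[OF inf_dim, of "(*\<^sub>V) J ` S" V] by auto
  define X :: "('n, 'k) op_tuple" where "X = (\<chi> i. adj C o\<^sub>C\<^sub>L V $ i o\<^sub>C\<^sub>L C)"
  have X_nth: "X $ i = adj C o\<^sub>C\<^sub>L V $ i o\<^sub>C\<^sub>L C" for i by (simp add: X_def)
  define W where "W = adj C o\<^sub>C\<^sub>L J"
  have "X \<in> row_cball"
  proof (rule row_cballI)
    fix k :: "'n \<Rightarrow> 'k"
    have "(\<Sum>i\<in>UNIV. X $ i *\<^sub>V k i) = adj C *\<^sub>V (\<Sum>i\<in>UNIV. V $ i *\<^sub>V C *\<^sub>V k i)"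
      by (simp add: X_nth cblinfun.sum_right)
    then have "(norm (\<Sum>i\<in>UNIV. X $ i *\<^sub>V k i))\<^sup>2 \<le> (norm (\<Sum>i\<in>UNIV. V $ i *\<^sub>V C *\<^sub>V k i))\<^sup>2"
      using adj_contraction[OF C(1)] by (simp add: power_mono)
    also have "\<dots> = (\<Sum>i\<in>UNIV. (norm (V $ i *\<^sub>V C *\<^sub>V k i))\<^sup>2)"
      by (rule norm_sum_cinner_orthogonal) (simp_all add: orth)
    also have "\<dots> \<le> (\<Sum>i\<in>UNIV. (norm (k i))\<^sup>2)"
      using V C(1) by (intro sum_mono power_mono) (simp_all add: isometry_def)
    finally show "(norm (\<Sum>i\<in>UNIV. X $ i *\<^sub>V k i))\<^sup>2 \<le> (\<Sum>i\<in>UNIV. (norm (k i))\<^sup>2)" .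
  qed
  moreover have CX: "C *\<^sub>V op_word X \<alpha> *\<^sub>V W *\<^sub>V x = op_word V \<alpha> *\<^sub>V J *\<^sub>V x" if "x \<in> S" for \<alpha> x
  proof (induction \<alpha>)
    case Nil
    show ?case using that by (simp add: W_def C)
  next
    case (Cons i \<alpha>)
    then show ?case
      using C(3)[of i "op_word X \<alpha> *\<^sub>V W *\<^sub>V x"] by (simp add: X_nth)
  qed
  moreover have W: "cinner z (W *\<^sub>V y) = cinner (C *\<^sub>V z) (J *\<^sub>V y)" for z y
    by (simp add: W_def cinner_adj)
  ultimately show ?thesis
    using T_word CX[where \<alpha> = "[]"] by (intro exI[of _ X] exI[of _ W]) (simp add: cinner_J)
qed

section \<open>Transferring norms along a compression\<close>

lemma norm_le_on_tensor_sums: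
  fixes Q :: "('p::chilbert_space, 'p) cblinfun"
  assumes t: "hilbert_tensor t" and "0 \<le> c"
    and bound: "\<And>L L'. cmod (cinner (Q *\<^sub>V tensor_sum t L) (tensor_sum t L'))
      \<le> c * norm (tensor_sum t L) * norm (tensor_sum t L')"
  shows "norm Q \<le> c"
proof (rule norm_cblinfun_bound[OF \<open>0 \<le> c\<close>])
  fix x
  have Lx: "cmod (cinner (Q *\<^sub>V tensor_sum t L) y) \<le> c * norm (tensor_sum t L) * norm y" for L y
  proof -
    have "closed {y. cmod (cinner (Q *\<^sub>V tensor_sum t L) y) \<le> c * norm (tensor_sum t L) * norm y}"
      by (intro closed_Collect_le continuous_intros cinner.continuous_on)
    then have "closure (range (tensor_sum t))
        \<subseteq> {y. cmod (cinner (Q *\<^sub>V tensor_sum t L) y) \<le> c * norm (tensor_sum t L) * norm y}"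
      using bound by (intro closure_minimal) auto
    then show ?thesis by (auto simp: closure_tensor_sum[OF t])
  qed
  have xy: "cmod (cinner (Q *\<^sub>V x) y) \<le> c * norm x * norm y" for y
  proof -
    have "closed {x. cmod (cinner (Q *\<^sub>V x) y) \<le> c * norm x * norm y}"
      by (intro closed_Collect_le continuous_intros cinner.continuous_on cblinfun.continuous_on)
    then have "closure (range (tensor_sum t)) \<subseteq> {x. cmod (cinner (Q *\<^sub>V x) y) \<le> c * norm x * norm y}"
      using Lx by (intro closure_minimal) auto
    then show ?thesis by (auto simp: closure_tensor_sum[OF t])
  qed
  have "(norm (Q *\<^sub>V x))\<^sup>2 \<le> c * norm x * norm (Q *\<^sub>V x)"
    using xy[of "Q *\<^sub>V x"] by (simp add: cinner_self norm_power)
  then show "norm (Q *\<^sub>V x) \<le> c * norm x"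
    using \<open>0 \<le> c\<close> by (cases "norm (Q *\<^sub>V x) = 0") (simp_all add: power2_eq_square)
qed

lemma countable_norming_set:
  fixes t :: "'a::chilbert_space \<Rightarrow> 'b::chilbert_space \<Rightarrow> 'p::chilbert_space"
  assumes t: "hilbert_tensor t" and "countable \<Q>"
  shows "\<exists>S. countable S \<and> (\<forall>Q\<in>\<Q>. \<forall>c\<ge>0.
    (\<forall>L L'. fst ` set L \<subseteq> S \<and> fst ` set L' \<subseteq> S \<longrightarrow>
      cmod (cinner (Q *\<^sub>V tensor_sum t L) (tensor_sum t L'))
        \<le> c * norm (tensor_sum t L) * norm (tensor_sum t L')) \<longrightarrow> norm Q \<le> c)"
proof -
  let ?good = "\<lambda>Q q L L'. q * norm (tensor_sum t L) * norm (tensor_sum t L')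
    < cmod (cinner (Q *\<^sub>V tensor_sum t L) (tensor_sum t L'))"
  have "\<forall>Q q. \<exists>L L'. 0 \<le> q \<longrightarrow> q < norm Q \<longrightarrow> ?good Q q L L'"
    using norm_le_on_tensor_sums[OF t] by (metis not_le)
  then obtain l l' where l: "\<And>Q q. 0 \<le> q \<Longrightarrow> q < norm Q \<Longrightarrow> ?good Q q (l Q q) (l' Q q)"
    by metis
  define S where "S = (\<Union>Q\<in>\<Q>. \<Union>q\<in>\<rat>. fst ` set (l Q q) \<union> fst ` set (l' Q q))"
  have "countable S"
    unfolding S_def using assms(2) countable_rat
    by (intro countable_UN countable_Un) (auto intro: countable_finite)
  moreover have "norm Q \<le> c" if "Q \<in> \<Q>" "c \<ge> 0"
    and c: "\<forall>L L'. fst ` set L \<subseteq> S \<and> fst ` set L' \<subseteq> S \<longrightarrow>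
      cmod (cinner (Q *\<^sub>V tensor_sum t L) (tensor_sum t L'))
        \<le> c * norm (tensor_sum t L) * norm (tensor_sum t L')" for Q c
  proof (rule ccontr)
    assume "\<not> norm Q \<le> c"
    then obtain q where q: "q \<in> \<rat>" "c < q" "q < norm Q"
      using Rats_dense_in_real[of c "norm Q"] by auto
    let ?x = "tensor_sum t (l Q q)" and ?y = "tensor_sum t (l' Q q)"
    have "fst ` set (l Q q) \<subseteq> S" "fst ` set (l' Q q) \<subseteq> S"
      unfolding S_def using that(1) q(1) by blast+
    with c have "cmod (cinner (Q *\<^sub>V ?x) ?y) \<le> c * norm ?x * norm ?y" by blast
    also have "\<dots> \<le> q * norm ?x * norm ?y"
      using q(2) by (intro mult_right_mono) auto
    also have "\<dots> < cmod (cinner (Q *\<^sub>V ?x) ?y)"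
      using l[of q Q] q \<open>c \<ge> 0\<close> by simp
    finally show False by simp
  qed
  ultimately show ?thesis by blast
qed

text \<open>\<open>Q\<close> is the compression of \<open>P\<close> along \<open>W \<otimes> I\<close>, as far as vectors from \<open>S\<close> can tell.\<close>

definition compression_on ::
  "('h::chilbert_space \<Rightarrow> 'e \<Rightarrow> 'p::chilbert_space) \<Rightarrow> ('k::chilbert_space \<Rightarrow> 'e \<Rightarrow> 'q::chilbert_space) \<Rightarrow>
   'h set \<Rightarrow> ('h, 'k) cblinfun \<Rightarrow> ('p, 'p) cblinfun \<Rightarrow> ('q, 'q) cblinfun \<Rightarrow> bool" where
  "compression_on tH tK S W Q P \<longleftrightarrow> (\<forall>x\<in>S. \<forall>y\<in>S. \<forall>a b.
     cinner (Q *\<^sub>V tH x a) (tH y b) = cinner (P *\<^sub>V tK (W *\<^sub>V x) a) (tK (W *\<^sub>V y) b))"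

lemma compression_on_add:
  "compression_on tH tK S W Q P \<Longrightarrow> compression_on tH tK S W Q' P' \<Longrightarrow>
    compression_on tH tK S W (Q + Q') (P + P')"
  by (simp add: compression_on_def cblinfun.add_left cinner_add_left)

lemma compression_on_diff:
  "compression_on tH tK S W Q P \<Longrightarrow> compression_on tH tK S W Q' P' \<Longrightarrow>
    compression_on tH tK S W (Q - Q') (P - P')"
  by (simp add: compression_on_def cblinfun.diff_left cinner.diff_left)

lemma compression_on_sum:
  "(\<And>i. i \<in> I \<Longrightarrow> compression_on tH tK S W (Q i) (P i)) \<Longrightarrow>
    compression_on tH tK S W (\<Sum>i\<in>I. Q i) (\<Sum>i\<in>I. P i)"
  by (simp add: compression_on_def cblinfun.sum_left cinner.sum_left)

lemma compression_on_suminf: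
  assumes "summable Q" "summable P" "\<And>i. compression_on tH tK S W (Q i) (P i)"
  shows "compression_on tH tK S W (\<Sum>i. Q i) (\<Sum>i. P i)"
proof -
  have eq: "cinner ((\<Sum>i. R i) *\<^sub>V x) y = (\<Sum>i. cinner (R i *\<^sub>V x) y)"
    if "summable R" for R :: "nat \<Rightarrow> ('x::complex_inner, 'y::chilbert_space) cblinfun" and x y
    using bounded_linear.suminf[OF bounded_linear_compose[OF cinner.bounded_linear_left
        cblinfun.bounded_linear_left] that] .
  show ?thesis
    using assms(3) unfolding compression_on_def eq[OF assms(1)] eq[OF assms(2)] by simp
qed

lemma tensor_sum_compression:
  assumes "compression_on tH tK S W Q P" "fst ` set L \<subseteq> S" "fst ` set L' \<subseteq> S"
  shows "cinner (Q *\<^sub>V tensor_sum tH L) (tensor_sum tH L')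
    = cinner (P *\<^sub>V tensor_sum tK (map (map_prod ((*\<^sub>V) W) id) L))
        (tensor_sum tK (map (map_prod ((*\<^sub>V) W) id) L'))"
proof -
  have "cinner (Q *\<^sub>V tH x a) (tensor_sum tH L')
    = cinner (P *\<^sub>V tK (W *\<^sub>V x) a) (tensor_sum tK (map (map_prod ((*\<^sub>V) W) id) L'))"
    if "x \<in> S" for x a
    using assms(3)
  proof (induction L')
    case (Cons p L')
    then show ?case using assms(1) that
      by (cases p) (simp add: cinner_add_right compression_on_def)
  qed (simp add: cinner.zero_right)
  with assms(2) show ?thesis
    by (induction L) (auto simp: cblinfun.zero_right cinner.zero_left cblinfun.add_right cinner_add_left)
qed

lemma dilation_of_countable_family:
  fixes tK :: "'k::chilbert_space \<Rightarrow> 'e::chilbert_space \<Rightarrow> 'ke::chilbert_space"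
    and tH :: "'h::chilbert_space \<Rightarrow> 'e \<Rightarrow> 'he::chilbert_space"
    and T :: "('n::finite, 'h) op_tuple" and \<Q> :: "('he, 'he) cblinfun set"
  assumes inf_dim: "\<not> (\<exists>S :: 'k set. finite S \<and> cspan S = UNIV)"
    and tK: "hilbert_tensor tK" and tH: "hilbert_tensor tH"
    and C: "class_C TYPE('g::chilbert_space) \<rho> T" and "countable \<Q>"
  obtains X :: "('n, 'k) op_tuple" and S :: "'h set" and W :: "('h, 'k) cblinfun"
  where "X \<in> row_cball"
    and "\<And>Q P. Q \<in> \<Q> \<Longrightarrow> compression_on tH tK S W Q P \<Longrightarrow> norm Q \<le> norm P"
    and "\<And>D. compression_on tH tK S W (op_tensor tH id_cblinfun D) (op_tensor tK id_cblinfun D)"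
    and "\<And>A r k. compression_on tH tK S W (hol_part tH A (r *\<^sub>R T) (Suc k))
      (\<rho> *\<^sub>R hol_part tK A (r *\<^sub>R X) (Suc k))"
    and "\<And>B r k. compression_on tH tK S W (antihol_part tH B (r *\<^sub>R T) (Suc k))
      (\<rho> *\<^sub>R antihol_part tK B (r *\<^sub>R X) (Suc k))"
proof -
  obtain S :: "'h set" where "countable S"
    and S: "\<And>Q c. Q \<in> \<Q> \<Longrightarrow> c \<ge> 0 \<Longrightarrow>
      (\<And>L L'. fst ` set L \<subseteq> S \<Longrightarrow> fst ` set L' \<subseteq> S \<Longrightarrow>
        cmod (cinner (Q *\<^sub>V tensor_sum tH L) (tensor_sum tH L'))
          \<le> c * norm (tensor_sum tH L) * norm (tensor_sum tH L')) \<Longrightarrow> norm Q \<le> c"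
    using countable_norming_set[OF tH \<open>countable \<Q>\<close>] by (elim exE conjE) metis
  obtain X :: "('n, 'k) op_tuple" and W :: "('h, 'k) cblinfun" where X: "X \<in> row_cball"
    and W: "\<And>x y. x \<in> S \<Longrightarrow> y \<in> S \<Longrightarrow> cinner (W *\<^sub>V x) (W *\<^sub>V y) = cinner x y"
    and word: "\<And>\<alpha> x y. \<alpha> \<noteq> [] \<Longrightarrow> x \<in> S \<Longrightarrow> y \<in> S \<Longrightarrow>
      cinner (op_word T \<alpha> *\<^sub>V x) y = \<rho> *\<^sub>R cinner (op_word X \<alpha> *\<^sub>V W *\<^sub>V x) (W *\<^sub>V y)"
    using class_C_compression[OF inf_dim C \<open>countable S\<close>] by blast
  have word_r: "cinner (op_word (r *\<^sub>R T) \<alpha> *\<^sub>V x) y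
      = \<rho> *\<^sub>R cinner (op_word (r *\<^sub>R X) \<alpha> *\<^sub>V W *\<^sub>V x) (W *\<^sub>V y)"
    if "\<alpha> \<noteq> []" "x \<in> S" "y \<in> S" for \<alpha> x y r
    by (simp add: op_word_scaleR cinner_scaleR_left word[OF that])
  have adj_word_r: "cinner (adj (op_word (r *\<^sub>R T) \<alpha>) *\<^sub>V x) y
      = \<rho> *\<^sub>R cinner (adj (op_word (r *\<^sub>R X) \<alpha>) *\<^sub>V W *\<^sub>V x) (W *\<^sub>V y)"
    if "\<alpha> \<noteq> []" "x \<in> S" "y \<in> S" for \<alpha> x y r
    using arg_cong[OF word_r[OF that(1,3,2), of r], of cnj]
    by (simp add: cinner_adj_left flip: cinner_commute)
  have hol: "compression_on tH tK S W (hol_part tH A (r *\<^sub>R T) (Suc k))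
      (\<rho> *\<^sub>R hol_part tK A (r *\<^sub>R X) (Suc k))" for A r k
    unfolding hol_part_def scaleR_sum_right
  proof (rule compression_on_sum)
    fix \<alpha> :: "'n list" assume "\<alpha> \<in> {\<alpha>. length \<alpha> = Suc k}"
    then have "\<alpha> \<noteq> []" by auto
    then show "compression_on tH tK S W (op_tensor tH (op_word (r *\<^sub>R T) \<alpha>) (A \<alpha>))
        (\<rho> *\<^sub>R op_tensor tK (op_word (r *\<^sub>R X) \<alpha>) (A \<alpha>))"
      by (simp add: compression_on_def op_tensor_apply[OF tH] op_tensor_apply[OF tK]
          tensor_simps(5)[OF tH] tensor_simps(5)[OF tK] word_r cblinfun.scaleR_left cinner_scaleR_left)
  qed
  have antihol: "compression_on tH tK S W (antihol_part tH B (r *\<^sub>R T) (Suc k))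
      (\<rho> *\<^sub>R antihol_part tK B (r *\<^sub>R X) (Suc k))" for B r k
    unfolding antihol_part_def scaleR_sum_right
  proof (rule compression_on_sum)
    fix \<alpha> :: "'n list" assume "\<alpha> \<in> {\<alpha>. length \<alpha> = Suc k}"
    then have "\<alpha> \<noteq> []" by auto
    then show "compression_on tH tK S W (op_tensor tH (adj (op_word (r *\<^sub>R T) \<alpha>)) (B \<alpha>))
        (\<rho> *\<^sub>R op_tensor tK (adj (op_word (r *\<^sub>R X) \<alpha>)) (B \<alpha>))"
      by (simp add: compression_on_def op_tensor_apply[OF tH] op_tensor_apply[OF tK]
          tensor_simps(5)[OF tH] tensor_simps(5)[OF tK] adj_word_r cblinfun.scaleR_left cinner_scaleR_left)
  qed
  have const: "compression_on tH tK S W (op_tensor tH id_cblinfun D) (op_tensor tK id_cblinfun D)" for D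
    by (simp add: compression_on_def op_tensor_apply[OF tH] op_tensor_apply[OF tK]
        tensor_simps(5)[OF tH] tensor_simps(5)[OF tK] W)
  have id: "compression_on tH tK S W id_cblinfun id_cblinfun"
    by (simp add: compression_on_def tensor_simps(5)[OF tH] tensor_simps(5)[OF tK] W)
  let ?W = "\<lambda>L. tensor_sum tK (map (map_prod ((*\<^sub>V) W) id) L)"
  have norm_W: "norm (?W L) = norm (tensor_sum tH L)" if "fst ` set L \<subseteq> S" for L
    using tensor_sum_compression[OF id that that]
    by (simp add: norm_eq_sqrt_inner flip: Re_cinner)
  have "norm Q \<le> norm P" if "Q \<in> \<Q>" and P: "compression_on tH tK S W Q P" for Q P
  proof (rule S[OF that(1)])
    fix L L' :: "('h \<times> 'e) list" assume L: "fst ` set L \<subseteq> S" "fst ` set L' \<subseteq> S"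
    have "cmod (cinner (Q *\<^sub>V tensor_sum tH L) (tensor_sum tH L')) = cmod (cinner (P *\<^sub>V ?W L) (?W L'))"
      by (simp add: tensor_sum_compression[OF P L])
    also have "\<dots> \<le> norm (P *\<^sub>V ?W L) * norm (?W L')" by (rule norm_cinner_le)
    also have "\<dots> \<le> norm P * norm (?W L) * norm (?W L')" by (intro mult_right_mono norm_cblinfun) simp
    finally show "cmod (cinner (Q *\<^sub>V tensor_sum tH L) (tensor_sum tH L'))
        \<le> norm P * norm (tensor_sum tH L) * norm (tensor_sum tH L')"
      by (simp add: norm_W L)
  qed simp
  then show thesis by (rule that[OF X _ const hol antihol])
qed

lemma summable_of_block_bound:
  fixes f :: "nat \<Rightarrow> 'a::banach" and g :: "nat \<Rightarrow> 'b::banach"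
  assumes "summable g" "\<And>m n. norm (\<Sum>k=m..<n. f k) \<le> norm (\<Sum>k=m..<n. g k)"
  shows "summable f"
  using assms unfolding summable_Cauchy by (meson le_less_trans)

theorem theorem1p3:
  fixes tK :: "'k::chilbert_space \<Rightarrow> 'e::chilbert_space \<Rightarrow> 'ke::chilbert_space"
    and tH :: "'h::chilbert_space \<Rightarrow> 'e \<Rightarrow> 'he::chilbert_space"
    and T :: "('n::finite, 'h) op_tuple"
    and u :: "('n, 'k) op_tuple \<Rightarrow> ('ke, 'ke) cblinfun"
    and A B :: "'n list \<Rightarrow> ('e, 'e) cblinfun"
    and \<rho> :: real
  assumes "separable_space (euclidean :: 'k topology)"
    and "\<not> (\<exists>S :: 'k set. finite S \<and> cspan S = UNIV)"
    and "separable_space (euclidean :: 'e topology)"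
    and "hilbert_tensor tK" and "hilbert_tensor tH"
    and "\<rho> > 0"
    and "class_C TYPE('g::chilbert_space) \<rho> T"
    and "u \<in> Har_c tK"
    and "\<And>X. X \<in> row_ball \<Longrightarrow> std_rep_converges tK A B X \<and> u X = std_rep tK A B X"
  shows "(\<forall>r\<in>{0..<1}. std_rep_converges tH A B (r *\<^sub>R T)) \<and>
    (\<exists>L. ((\<lambda>r. std_rep tH A B (r *\<^sub>R T)) \<longlongrightarrow> L) (at_left 1) \<and>
      ereal (norm L)
        \<le> ball_norm (\<lambda>X. \<rho> *\<^sub>R u X + (1 - \<rho>) *\<^sub>R op_tensor tK id_cblinfun (A [])))"
proof -
  note inf_dim = assms(2) and tK = assms(4) and tH = assms(5)
  note dilate = dilation_of_countable_family[OF inf_dim tK tH assms(7)]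
  have conv_K: "summable (\<lambda>k. antihol_part tK B (r *\<^sub>R X) (Suc k))"
      "summable (\<lambda>k. hol_part tK A (r *\<^sub>R X) (Suc k))"
      "u (r *\<^sub>R X) = std_rep tK A B (r *\<^sub>R X)"
    if "X \<in> row_cball" "0 \<le> r" "r < 1" for X r
    using assms(9)[OF row_ball_scaleR[OF that]] by (simp_all add: std_rep_converges_def)
  have conv_H: "summable (\<lambda>k. antihol_part tH B (r *\<^sub>R T) (Suc k))"
      "summable (\<lambda>k. hol_part tH A (r *\<^sub>R T) (Suc k))"
    if r: "0 \<le> r" "r < 1" for r
  proof -
    let ?a = "\<lambda>p. \<Sum>k=fst p..<snd p. antihol_part tH B (r *\<^sub>R T) (Suc k)"
    let ?h = "\<lambda>p. \<Sum>k=fst p..<snd p. hol_part tH A (r *\<^sub>R T) (Suc k)"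
    have "countable (range ?a \<union> range ?h)" by simp
    then obtain X S W where X: "X \<in> row_cball"
      and le: "\<And>Q P. Q \<in> range ?a \<union> range ?h \<Longrightarrow> compression_on tH tK S W Q P \<Longrightarrow> norm Q \<le> norm P"
      and hol: "\<And>A r k. compression_on tH tK S W (hol_part tH A (r *\<^sub>R T) (Suc k))
        (\<rho> *\<^sub>R hol_part tK A (r *\<^sub>R X) (Suc k))"
      and antihol: "\<And>B r k. compression_on tH tK S W (antihol_part tH B (r *\<^sub>R T) (Suc k))
        (\<rho> *\<^sub>R antihol_part tK B (r *\<^sub>R X) (Suc k))"
      by (rule dilate) blast
    show "summable (\<lambda>k. antihol_part tH B (r *\<^sub>R T) (Suc k))"
    proof (rule summable_of_block_bound)
      show "summable (\<lambda>k. \<rho> *\<^sub>R antihol_part tK B (r *\<^sub>R X) (Suc k))"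
        by (intro summable_scaleR_right conv_K X r)
      show "norm (\<Sum>k=m..<n. antihol_part tH B (r *\<^sub>R T) (Suc k))
          \<le> norm (\<Sum>k=m..<n. \<rho> *\<^sub>R antihol_part tK B (r *\<^sub>R X) (Suc k))" for m n
        by (intro le UnI1 image_eqI[of _ _ "(m, n)"] compression_on_sum antihol) auto
    qed
    show "summable (\<lambda>k. hol_part tH A (r *\<^sub>R T) (Suc k))"
    proof (rule summable_of_block_bound)
      show "summable (\<lambda>k. \<rho> *\<^sub>R hol_part tK A (r *\<^sub>R X) (Suc k))"
        by (intro summable_scaleR_right conv_K X r)
      show "norm (\<Sum>k=m..<n. hol_part tH A (r *\<^sub>R T) (Suc k))
          \<le> norm (\<Sum>k=m..<n. \<rho> *\<^sub>R hol_part tK A (r *\<^sub>R X) (Suc k))" for m n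
        by (intro le UnI2 image_eqI[of _ _ "(m, n)"] compression_on_sum hol) auto
    qed
  qed
  define g where "g r = std_rep tH A B (r *\<^sub>R T)" for r
  define w where "w X = \<rho> *\<^sub>R u X + (1 - \<rho>) *\<^sub>R op_tensor tK id_cblinfun (A [])" for X
  have dilate_g: "\<exists>X\<in>row_cball. \<exists>S W. (\<forall>Q\<in>\<Q>. \<forall>P. compression_on tH tK S W Q P \<longrightarrow> norm Q \<le> norm P) \<and>
      (\<forall>r. 0 \<le> r \<longrightarrow> r < 1 \<longrightarrow> compression_on tH tK S W (g r) (w (r *\<^sub>R X)))"
    if "countable \<Q>" for \<Q>
  proof -
    from that obtain X S W where X: "X \<in> row_cball"
      and le: "\<And>Q P. Q \<in> \<Q> \<Longrightarrow> compression_on tH tK S W Q P \<Longrightarrow> norm Q \<le> norm P"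
      and const: "\<And>D. compression_on tH tK S W (op_tensor tH id_cblinfun D) (op_tensor tK id_cblinfun D)"
      and hol: "\<And>A r k. compression_on tH tK S W (hol_part tH A (r *\<^sub>R T) (Suc k))
        (\<rho> *\<^sub>R hol_part tK A (r *\<^sub>R X) (Suc k))"
      and antihol: "\<And>B r k. compression_on tH tK S W (antihol_part tH B (r *\<^sub>R T) (Suc k))
        (\<rho> *\<^sub>R antihol_part tK B (r *\<^sub>R X) (Suc k))"
      by (rule dilate) blast
    have "compression_on tH tK S W (g r) (w (r *\<^sub>R X))" if r: "0 \<le> r" "r < 1" for r
    proof -
      note sK = conv_K(1,2)[OF X r]
      have "w (r *\<^sub>R X) = (\<Sum>k. \<rho> *\<^sub>R antihol_part tK B (r *\<^sub>R X) (Suc k))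
          + op_tensor tK id_cblinfun (A []) + (\<Sum>k. \<rho> *\<^sub>R hol_part tK A (r *\<^sub>R X) (Suc k))"
        by (simp add: w_def conv_K(3)[OF X r] std_rep_def suminf_scaleR_right[OF sK(1), symmetric]
            suminf_scaleR_right[OF sK(2), symmetric] algebra_simps)
      then show ?thesis
        unfolding g_def std_rep_def
        by (simp only:) (intro compression_on_add compression_on_suminf const hol antihol conv_H[OF r]
            summable_scaleR_right sK)
    qed
    with X le show ?thesis by blast
  qed
  have g_le: "ereal (norm (g r)) \<le> ball_norm w" if r: "0 \<le> r" "r < 1" for r
  proof -
    obtain X where X: "X \<in> row_cball" "norm (g r) \<le> norm (w (r *\<^sub>R X))"
      using dilate_g[of "{g r}"] r by blast
    have "ereal (norm (g r)) \<le> ereal (norm (w (r *\<^sub>R X)))" using X(2) by simp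
    also have "\<dots> \<le> ball_norm w"
      unfolding ball_norm_def by (rule SUP_upper[OF row_ball_scaleR[OF X(1) r]])
    finally show ?thesis .
  qed
  obtain v where v: "continuous_on row_cball v" "\<And>X. X \<in> row_ball \<Longrightarrow> v X = u X"
    using assms(8) unfolding Har_c_def by blast
  have u_lim: "(\<lambda>m. u (s m *\<^sub>R X)) \<longlonglongrightarrow> v X"
    if X: "X \<in> row_cball" and s: "s \<longlonglongrightarrow> 1" "\<And>m. 0 \<le> s m \<and> s m < 1" for X and s :: "nat \<Rightarrow> real"
  proof -
    have ball: "s m *\<^sub>R X \<in> row_ball" for m using row_ball_scaleR[OF X] s(2) by blast
    have "(\<lambda>m. s m *\<^sub>R X) \<longlonglongrightarrow> X" using tendsto_scaleR[OF s(1) tendsto_const[of X]] by simp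
    then have "(\<lambda>m. v (s m *\<^sub>R X)) \<longlonglongrightarrow> v X"
      by (rule continuous_on_tendsto_compose[OF v(1) _ X])
        (use ball row_cball_subset in \<open>auto intro!: always_eventually\<close>)
    then show ?thesis by (simp add: v(2) ball)
  qed
  have Cauchy_g: "\<exists>\<delta>\<in>{0<..<1}. \<forall>r s. 1 - \<delta> < r \<and> r < 1 \<and> 1 - \<delta> < s \<and> s < 1 \<longrightarrow> dist (g r) (g s) < \<epsilon>"
    if "\<epsilon> > 0" for \<epsilon>
  proof (rule ccontr)
    assume not: "\<not> ?thesis"
    define \<delta> where "\<delta> m = inverse (real (Suc (Suc m)))" for m
    have \<delta>: "0 < \<delta> m" "\<delta> m < 1" for m by (simp_all add: \<delta>_def inverse_less_1_iff)
    have "\<forall>m. \<exists>r s. 1 - \<delta> m < r \<and> r < 1 \<and> 1 - \<delta> m < s \<and> s < 1 \<and> \<epsilon> \<le> dist (g r) (g s)"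
      using not \<delta> by (auto simp: not_less)
    then obtain r s where rs: "\<And>m. 1 - \<delta> m < r m" "\<And>m. r m < 1" "\<And>m. 1 - \<delta> m < s m" "\<And>m. s m < 1"
      "\<And>m. \<epsilon> \<le> dist (g (r m)) (g (s m))"
      by metis
    have \<delta>_lim: "(\<lambda>m. 1 - \<delta> m) \<longlonglongrightarrow> 1"
      using tendsto_diff[OF tendsto_const LIMSEQ_Suc[OF LIMSEQ_inverse_real_of_nat], of 1]
      by (simp add: \<delta>_def)
    have lim: "r \<longlonglongrightarrow> 1" "s \<longlonglongrightarrow> 1"
      by (rule tendsto_sandwich[OF _ _ \<delta>_lim tendsto_const];
          use rs in \<open>auto intro!: always_eventually less_imp_le\<close>)+
    have range: "0 \<le> r m \<and> r m < 1" "0 \<le> s m \<and> s m < 1" for m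
      using rs(1-4)[of m] \<delta>[of m] by linarith+
    obtain X S W where X: "X \<in> row_cball"
      and le: "\<And>m P. compression_on tH tK S W (g (r m) - g (s m)) P \<Longrightarrow> norm (g (r m) - g (s m)) \<le> norm P"
      and comp: "\<And>r. 0 \<le> r \<Longrightarrow> r < 1 \<Longrightarrow> compression_on tH tK S W (g r) (w (r *\<^sub>R X))"
      using dilate_g[of "range (\<lambda>m. g (r m) - g (s m))"] by auto
    have "\<epsilon> \<le> norm (\<rho> *\<^sub>R u (r m *\<^sub>R X) - \<rho> *\<^sub>R u (s m *\<^sub>R X))" for m
      using rs(5)[of m] le[OF compression_on_diff[OF comp comp], of m] range[of m]
      by (simp add: dist_norm w_def)
    moreover have "(\<lambda>m. norm (\<rho> *\<^sub>R u (r m *\<^sub>R X) - \<rho> *\<^sub>R u (s m *\<^sub>R X))) \<longlonglongrightarrow> norm (\<rho> *\<^sub>R v X - \<rho> *\<^sub>R v X)"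
      by (intro tendsto_intros u_lim X lim range)
    ultimately have "\<epsilon> \<le> norm (\<rho> *\<^sub>R v X - \<rho> *\<^sub>R v X)"
      by (intro LIMSEQ_le_const) auto
    with \<open>\<epsilon> > 0\<close> show False by simp
  qed
  have "cauchy_filter (filtermap g (at_left 1))"
    unfolding cauchy_filter_metric_filtermap
  proof (intro allI impI)
    fix \<epsilon> :: real assume "\<epsilon> > 0"
    from Cauchy_g[OF this] obtain \<delta> where \<delta>: "\<delta> \<in> {0<..<1}"
      "\<And>r s. 1 - \<delta> < r \<and> r < 1 \<and> 1 - \<delta> < s \<and> s < 1 \<Longrightarrow> dist (g r) (g s) < \<epsilon>"
      by blast
    have "eventually (\<lambda>r. r \<in> {1 - \<delta><..<1}) (at_left 1)"
      using \<delta>(1) by (intro eventually_at_leftI[of "1 - \<delta>"]) auto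
    with \<delta>(2) show "\<exists>P. eventually P (at_left 1) \<and> (\<forall>x y. P x \<and> P y \<longrightarrow> dist (g x) (g y) < \<epsilon>)"
      by (intro exI[of _ "\<lambda>r. r \<in> {1 - \<delta><..<1}"]) auto
  qed
  then have "convergent_filter (filtermap g (at_left 1))" by (rule cauchy_filter_convergent)
  then obtain L where L: "(g \<longlongrightarrow> L) (at_left 1)"
    by (auto simp: convergent_filter_iff filterlim_def)
  have "ereal (norm L) \<le> ball_norm w"
  proof (rule tendsto_upperbound)
    show "((\<lambda>r. ereal (norm (g r))) \<longlongrightarrow> ereal (norm L)) (at_left 1)"
      by (intro tendsto_intros L)
    have "eventually (\<lambda>r. r \<in> {0<..<1}) (at_left (1::real))"
      by (intro eventually_at_leftI[of 0]) auto
    then show "\<forall>\<^sub>F r in at_left 1. ereal (norm (g r)) \<le> ball_norm w"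
      by eventually_elim (auto intro: g_le)
  qed simp
  with L conv_H show ?thesis
    unfolding g_def[abs_def] w_def[abs_def] std_rep_converges_def by auto
qed

end
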